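(* Let $(M,J,g)$ be an almost complex manifold with Norden metric, $\dim M=2n$, and let $\tilde g(x,y)=g(Jx,y)$ be its associated Norden metric. Then all classes $\mathcal W_0$, $\mathcal W_1$, $\mathcal W_2$, $\mathcal W_3$, $\mathcal W_1\oplus\mathcal W_2$, $\mathcal W_1\oplus\mathcal W_3$, $\mathcal W_2\oplus\mathcal W_3$, $\mathcal W_1\oplus\mathcal W_2\oplus\mathcal W_3$ are invariant under the twin interchange; that is, for each of these classes, $(M,J,g)$ belongs to the class if and only if $(M,J,\tilde g)$ belongs to it.
   Context: An almost complex manifold with Norden metric (almost Norden manifold) $(M,J,g)$ is a $2n$-dimensional manifold with an almost complex structure $J$ ($J^2=-I$) and a pseudo-Riemannian metric $g$ such that $g(Jx,Jy)=-g(x,y)$. The associated metric $\tilde g(x,y)=g(Jx,y)$ is again a Norden metric (both metrics have signature $(n,n)$), so $(M,J,\tilde g)$ is also an almost Norden manifold; the associated metric of $\tilde g$ is $-g$. Let $D$ and $\tilde D$ be the Levi-Civita connections of $g$ and $\tilde g$. The twin interchange is the interchange of $D$ and $\tilde D$ (and respectively of the metrics $g$ and $\tilde g$). For $(M,J,g)$ put $F(x,y,z)=g((D_xJ)y,z)$ and $\theta(z)=g^{ij}F(e_i,e_j,z)$, where $\{e_i\}$ is a basis of the tangent space and $(g^{ij})$ is the inverse of the matrix of $g$. Let $\mathfrak S_{x,y,z}$ denote the cyclic sum over $x,y,z$. The classes are defined by the following conditions for all $x,y,z$: $\mathcal W_0$: $F=0$; $\mathcal W_1$: $F(x,y,z)=\frac1{2n}\{g(x,y)\theta(z)+g(Jx,y)\theta(Jz)+g(x,z)\theta(y)+g(Jx,z)\theta(Jy)\}$;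 $\mathcal W_2$: $\mathfrak S_{x,y,z}F(x,y,Jz)=0$ and $\theta=0$; $\mathcal W_3$: $\mathfrak S_{x,y,z}F(x,y,z)=0$; $\mathcal W_1\oplus\mathcal W_2$: $\mathfrak S_{x,y,z}F(x,y,Jz)=0$; $\mathcal W_1\oplus\mathcal W_3$: $\mathfrak S_{x,y,z}F(x,y,z)=\frac1n\mathfrak S_{x,y,z}\{g(x,y)\theta(z)+g(Jx,y)\theta(Jz)\}$; $\mathcal W_2\oplus\mathcal W_3$: $\theta=0$; $\mathcal W_1\oplus\mathcal W_2\oplus\mathcal W_3$: no condition. Membership of $(M,J,\tilde g)$ is defined by the same conditions with $g$, $D$ replaced everywhere by $\tilde g$, $\tilde D$. *)

theory Defs
  imports "HOL-Analysis.Analysis" "HOL-Library.Function_Algebras"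
begin

section \<open>Smooth maps between Euclidean spaces\<close>

text \<open>
  Intended for open sets in finite-dimensional spaces: a map is of class \<open>C\<^sup>k\<^sup>+\<^sup>1\<close>
  iff it is differentiable and each of its directional derivatives is of class \<open>C\<^sup>k\<close>.
\<close>

primrec Ck_on :: "nat \<Rightarrow> 'a::euclidean_space set \<Rightarrow> ('a \<Rightarrow> 'b::real_normed_vector) \<Rightarrow> bool"
  where
    "Ck_on 0 S f \<longleftrightarrow> continuous_on S f"
  | "Ck_on (Suc k) S f \<longleftrightarrow>
       (\<forall>x\<in>S. f differentiable (at x)) \<and> (\<forall>v. Ck_on k S (\<lambda>x. frechet_derivative f (at x) v))"

definition smooth_on :: "'a::euclidean_space set \<Rightarrow> ('a \<Rightarrow> 'b::real_normed_vector) \<Rightarrow> bool"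
  where "smooth_on S f \<longleftrightarrow> (\<forall>k. Ck_on k S f)"

section \<open>Smooth manifolds\<close>

text \<open>
  A chart is a pair of its domain and a coordinate map. A smooth structure is given by an atlas,
  which need not be maximal. All notions below depend only on the smooth structure.
\<close>

type_synonym ('m, 'e) chart = "'m set \<times> ('m \<Rightarrow> 'e)"

record ('m, 'e) mfd =
  top_of :: "'m topology"
  atlas :: "('m, 'e) chart set"

abbreviation points :: "('m, 'e) mfd \<Rightarrow> 'm set"
  where "points M \<equiv> topspace (top_of M)"

definition chart_dom :: "('m, 'e) chart \<Rightarrow> 'm set"
  where "chart_dom c = fst c"

definition coord :: "('m, 'e) chart \<Rightarrow> 'm \<Rightarrow> 'e"
  where "coord c = snd c"

definition coord_inv :: "('m, 'e) chart \<Rightarrow> 'e \<Rightarrow> 'm"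
  where "coord_inv c = inv_into (chart_dom c) (coord c)"

definition charts_at :: "('m, 'e) mfd \<Rightarrow> 'm \<Rightarrow> ('m, 'e) chart set"
  where "charts_at M p = {c \<in> atlas M. p \<in> chart_dom c}"

definition smooth_manifold :: "('m, 'e::euclidean_space) mfd \<Rightarrow> bool"
  where "smooth_manifold M \<longleftrightarrow>
    Hausdorff_space (top_of M) \<and> second_countable (top_of M) \<and>
    (\<Union>c\<in>atlas M. chart_dom c) = points M \<and>
    (\<forall>c\<in>atlas M. openin (top_of M) (chart_dom c) \<and> open (coord c ` chart_dom c) \<and>
       homeomorphic_map (subtopology (top_of M) (chart_dom c)) (top_of_set (coord c ` chart_dom c)) (coord c)) \<and>
    (\<forall>c\<in>atlas M. \<forall>c'\<in>atlas M.
       smooth_on (coord c ` (chart_dom c \<inter> chart_dom c')) (coord c' \<circ> coord_inv c))"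

section \<open>Tangent vectors, vector fields, functions\<close>

instantiation "fun" :: (type, real_vector) real_vector
begin

definition scaleR_fun :: "real \<Rightarrow> ('a \<Rightarrow> 'b) \<Rightarrow> 'a \<Rightarrow> 'b"
  where "scaleR_fun a f = (\<lambda>x. a *\<^sub>R f x)"

instance
  by standard (simp_all add: scaleR_fun_def fun_eq_iff algebra_simps)

end

text \<open>
  A tangent vector at \<open>p\<close> assigns to each chart at \<open>p\<close> its component vector, the components in
  different charts being related by the derivative of the transition map. It is set to zero on
  all other charts, so that the tangent space is a linear subspace of the function space.
\<close>

type_synonym ('m, 'e) tvec = "('m, 'e) chart \<Rightarrow> 'e"

definition tangent_space :: "('m, 'e::euclidean_space) mfd \<Rightarrow> 'm \<Rightarrow> ('m, 'e) tvec set"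
  where "tangent_space M p =
    {u. (\<forall>c\<in>charts_at M p. \<forall>c'\<in>charts_at M p.
           u c' = frechet_derivative (coord c' \<circ> coord_inv c) (at (coord c p)) (u c)) \<and>
        (\<forall>c. c \<notin> charts_at M p \<longrightarrow> u c = 0)}"

definition smooth_fun :: "('m, 'e::euclidean_space) mfd \<Rightarrow> 'm set \<Rightarrow> ('m \<Rightarrow> real) \<Rightarrow> bool"
  where "smooth_fun M U f \<longleftrightarrow> openin (top_of M) U \<and>
    (\<forall>c\<in>atlas M. smooth_on (coord c ` (U \<inter> chart_dom c)) (f \<circ> coord_inv c))"

definition smooth_vf :: "('m, 'e::euclidean_space) mfd \<Rightarrow> 'm set \<Rightarrow> ('m \<Rightarrow> ('m, 'e) tvec) \<Rightarrow> bool"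
  where "smooth_vf M U X \<longleftrightarrow> openin (top_of M) U \<and> (\<forall>q\<in>U. X q \<in> tangent_space M q) \<and>
    (\<forall>c\<in>atlas M. smooth_on (coord c ` (U \<inter> chart_dom c)) (\<lambda>v. X (coord_inv c v) c))"

text \<open>Smooth functions and smooth vector fields defined on some neighbourhood of a point.\<close>

definition funs_near :: "('m, 'e::euclidean_space) mfd \<Rightarrow> 'm \<Rightarrow> ('m \<Rightarrow> real) set"
  where "funs_near M p = {f. \<exists>U. p \<in> U \<and> smooth_fun M U f}"

definition vfs_near :: "('m, 'e::euclidean_space) mfd \<Rightarrow> 'm \<Rightarrow> ('m \<Rightarrow> ('m, 'e) tvec) set"
  where "vfs_near M p = {X. \<exists>U. p \<in> U \<and> smooth_vf M U X}"

text \<open>The derivative of \<open>f\<close> along a tangent vector \<open>x\<close> at \<open>p\<close>; every chart gives the same value.\<close>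

definition deriv_along ::
    "('m, 'e::euclidean_space) mfd \<Rightarrow> 'm \<Rightarrow> ('m, 'e) tvec \<Rightarrow> ('m \<Rightarrow> real) \<Rightarrow> real"
  where "deriv_along M p x f =
    (let c = (SOME c. c \<in> charts_at M p)
     in frechet_derivative (f \<circ> coord_inv c) (at (coord c p)) (x c))"

definition lie_bracket ::
    "('m, 'e::euclidean_space) mfd \<Rightarrow> ('m \<Rightarrow> ('m, 'e) tvec) \<Rightarrow> ('m \<Rightarrow> ('m, 'e) tvec) \<Rightarrow>
     'm \<Rightarrow> ('m, 'e) tvec"
  where "lie_bracket M X Y p = (\<lambda>c. if c \<in> charts_at M p then
       frechet_derivative (\<lambda>v. Y (coord_inv c v) c) (at (coord c p)) (X p c) -
       frechet_derivative (\<lambda>v. X (coord_inv c v) c) (at (coord c p)) (Y p c)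
     else 0)"

section \<open>Almost complex structures, metrics and connections\<close>

type_synonym ('m, 'e) endo_field = "'m \<Rightarrow> ('m, 'e) tvec \<Rightarrow> ('m, 'e) tvec"
type_synonym ('m, 'e) bilin_field = "'m \<Rightarrow> ('m, 'e) tvec \<Rightarrow> ('m, 'e) tvec \<Rightarrow> real"

text \<open>
  A tensor field is smooth if it maps smooth vector fields on open sets to smooth objects.
\<close>

definition almost_complex_structure ::
    "('m, 'e::euclidean_space) mfd \<Rightarrow> ('m, 'e) endo_field \<Rightarrow> bool"
  where "almost_complex_structure M J \<longleftrightarrow>
    (\<forall>p\<in>points M.
       (\<forall>x\<in>tangent_space M p. J p x \<in> tangent_space M p \<and> J p (J p x) = - x) \<and>
       (\<forall>x\<in>tangent_space M p. \<forall>y\<in>tangent_space M p. \<forall>a b.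
          J p (a *\<^sub>R x + b *\<^sub>R y) = a *\<^sub>R J p x + b *\<^sub>R J p y)) \<and>
    (\<forall>U X. smooth_vf M U X \<longrightarrow> smooth_vf M U (\<lambda>q. J q (X q)))"

text \<open>
  The index of a smooth nondegenerate symmetric form is locally constant. No condition on the
  signature is imposed; a Norden metric automatically has neutral signature at every point.
\<close>

definition pseudo_riemannian_metric ::
    "('m, 'e::euclidean_space) mfd \<Rightarrow> ('m, 'e) bilin_field \<Rightarrow> bool"
  where "pseudo_riemannian_metric M g \<longleftrightarrow>
    (\<forall>p\<in>points M.
       (\<forall>x\<in>tangent_space M p. \<forall>y\<in>tangent_space M p. g p x y = g p y x) \<and>
       (\<forall>x\<in>tangent_space M p. \<forall>y\<in>tangent_space M p. \<forall>z\<in>tangent_space M p. \<forall>a b.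
          g p (a *\<^sub>R x + b *\<^sub>R y) z = a * g p x z + b * g p y z) \<and>
       (\<forall>x\<in>tangent_space M p. (\<forall>y\<in>tangent_space M p. g p x y = 0) \<longrightarrow> x = 0)) \<and>
    (\<forall>U X Y. smooth_vf M U X \<and> smooth_vf M U Y \<longrightarrow> smooth_fun M U (\<lambda>q. g q (X q) (Y q)))"

definition almost_norden_manifold ::
    "nat \<Rightarrow> ('m, 'e::euclidean_space) mfd \<Rightarrow> ('m, 'e) endo_field \<Rightarrow> ('m, 'e) bilin_field \<Rightarrow> bool"
  where "almost_norden_manifold n M J g \<longleftrightarrow>
    smooth_manifold M \<and> DIM('e) = 2 * n \<and>
    almost_complex_structure M J \<and> pseudo_riemannian_metric M g \<and>
    (\<forall>p\<in>points M. \<forall>x\<in>tangent_space M p. \<forall>y\<in>tangent_space M p.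
       g p (J p x) (J p y) = - g p x y)"

definition associated_metric ::
    "('m, 'e) endo_field \<Rightarrow> ('m, 'e) bilin_field \<Rightarrow> ('m, 'e) bilin_field"
  where "associated_metric J g = (\<lambda>p x y. g p (J p x) y)"

text \<open>
  \<open>D p x Y\<close> is the covariant derivative at \<open>p\<close>, in the direction of the tangent vector \<open>x\<close>, of a
  vector field \<open>Y\<close> given on a neighbourhood of \<open>p\<close>. Every connection on globally defined vector
  fields extends uniquely to such an operator.
\<close>

type_synonym ('m, 'e) connection = "'m \<Rightarrow> ('m, 'e) tvec \<Rightarrow> ('m \<Rightarrow> ('m, 'e) tvec) \<Rightarrow> ('m, 'e) tvec"

definition affine_connection ::
    "('m, 'e::euclidean_space) mfd \<Rightarrow> ('m, 'e) connection \<Rightarrow> bool"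
  where "affine_connection M D \<longleftrightarrow>
    (\<forall>p\<in>points M.
       (\<forall>x\<in>tangent_space M p. \<forall>Y\<in>vfs_near M p. D p x Y \<in> tangent_space M p) \<and>
       (\<forall>x\<in>tangent_space M p. \<forall>y\<in>tangent_space M p. \<forall>Z\<in>vfs_near M p. \<forall>a b.
          D p (a *\<^sub>R x + b *\<^sub>R y) Z = a *\<^sub>R D p x Z + b *\<^sub>R D p y Z) \<and>
       (\<forall>x\<in>tangent_space M p. \<forall>Y\<in>vfs_near M p. \<forall>Z\<in>vfs_near M p.
          D p x (\<lambda>q. Y q + Z q) = D p x Y + D p x Z) \<and>
       (\<forall>x\<in>tangent_space M p. \<forall>f\<in>funs_near M p. \<forall>Y\<in>vfs_near M p.
          D p x (\<lambda>q. f q *\<^sub>R Y q) = deriv_along M p x f *\<^sub>R Y p + f p *\<^sub>R D p x Y) \<and>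
       (\<forall>x\<in>tangent_space M p. \<forall>Y\<in>vfs_near M p. \<forall>Z\<in>vfs_near M p.
          (\<exists>U. openin (top_of M) U \<and> p \<in> U \<and> (\<forall>q\<in>U. Y q = Z q)) \<longrightarrow> D p x Y = D p x Z)) \<and>
    (\<forall>U X Y. smooth_vf M U X \<and> smooth_vf M U Y \<longrightarrow> smooth_vf M U (\<lambda>q. D q (X q) Y))"

definition levi_civita_connection ::
    "('m, 'e::euclidean_space) mfd \<Rightarrow> ('m, 'e) bilin_field \<Rightarrow> ('m, 'e) connection \<Rightarrow> bool"
  where "levi_civita_connection M g D \<longleftrightarrow>
    affine_connection M D \<and>
    (\<forall>p\<in>points M. \<forall>X\<in>vfs_near M p. \<forall>Y\<in>vfs_near M p.
       D p (X p) Y - D p (Y p) X = lie_bracket M X Y p) \<and>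
    (\<forall>p\<in>points M. \<forall>x\<in>tangent_space M p. \<forall>Y\<in>vfs_near M p. \<forall>Z\<in>vfs_near M p.
       deriv_along M p x (\<lambda>q. g q (Y q) (Z q)) = g p (D p x Y) (Z p) + g p (Y p) (D p x Z))"

section \<open>The tensor \<open>F\<close> and its trace \<open>\<theta>\<close>\<close>

text \<open>
  \<open>(D\<^sub>x J) y = D\<^sub>x (J Y) - J (D\<^sub>x Y)\<close> for a local vector field \<open>Y\<close> with \<open>Y p = y\<close>; the value does
  not depend on the choice of \<open>Y\<close>.
\<close>

definition nabla_J ::
    "('m, 'e::euclidean_space) mfd \<Rightarrow> ('m, 'e) endo_field \<Rightarrow> ('m, 'e) connection \<Rightarrow>
     'm \<Rightarrow> ('m, 'e) tvec \<Rightarrow> ('m, 'e) tvec \<Rightarrow> ('m, 'e) tvec"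
  where "nabla_J M J D p x y =
    (let Y = (SOME Y. Y \<in> vfs_near M p \<and> Y p = y)
     in D p x (\<lambda>q. J q (Y q)) - J p (D p x Y))"

definition F_tensor ::
    "('m, 'e::euclidean_space) mfd \<Rightarrow> ('m, 'e) endo_field \<Rightarrow> ('m, 'e) bilin_field \<Rightarrow>
     ('m, 'e) connection \<Rightarrow> 'm \<Rightarrow> ('m, 'e) tvec \<Rightarrow> ('m, 'e) tvec \<Rightarrow> ('m, 'e) tvec \<Rightarrow> real"
  where "F_tensor M J g D p x y z = g p (nabla_J M J D p x y) z"

definition tangent_basis :: "('m, 'e::euclidean_space) mfd \<Rightarrow> 'm \<Rightarrow> ('m, 'e) tvec set \<Rightarrow> bool"
  where "tangent_basis M p B \<longleftrightarrow> independent B \<and> span B = tangent_space M p"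

definition inverse_matrix_on :: "'i set \<Rightarrow> ('i \<Rightarrow> 'i \<Rightarrow> real) \<Rightarrow> ('i \<Rightarrow> 'i \<Rightarrow> real) \<Rightarrow> bool"
  where "inverse_matrix_on B G H \<longleftrightarrow>
    (\<forall>a\<in>B. \<forall>b\<in>B. (\<Sum>c\<in>B. G a c * H c b) = (if a = b then 1 else 0) \<and>
                     (\<Sum>c\<in>B. H a c * G c b) = (if a = b then 1 else 0))"

text \<open>
  A basis \<open>B\<close> of the tangent space serves as its own index set. The result does not depend on
  the chosen basis, and on \<open>B\<close> the inverse matrix is unique.
\<close>

definition theta_form ::
    "('m, 'e::euclidean_space) mfd \<Rightarrow> ('m, 'e) endo_field \<Rightarrow> ('m, 'e) bilin_field \<Rightarrow>
     ('m, 'e) connection \<Rightarrow> 'm \<Rightarrow> ('m, 'e) tvec \<Rightarrow> real"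
  where "theta_form M J g D p z =
    (let B = (SOME B. tangent_basis M p B);
         H = (SOME H. inverse_matrix_on B (g p) H)
     in \<Sum>a\<in>B. \<Sum>b\<in>B. H a b * F_tensor M J g D p a b z)"

section \<open>The basic classes\<close>

definition cyclic_sum :: "('v \<Rightarrow> 'v \<Rightarrow> 'v \<Rightarrow> real) \<Rightarrow> 'v \<Rightarrow> 'v \<Rightarrow> 'v \<Rightarrow> real"
  where "cyclic_sum T x y z = T x y z + T y z x + T z x y"

datatype norden_class = W0 | W1 | W2 | W3 | W1_W2 | W1_W3 | W2_W3 | W1_W2_W3

text \<open>
  The defining condition of a class at a point, in terms of the tangent space \<open>V\<close> and the values
  of \<open>J\<close>, \<open>g\<close>, \<open>F\<close>, \<open>\<theta>\<close> at that point.
\<close>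

primrec class_condition ::
    "norden_class \<Rightarrow> nat \<Rightarrow> 'v set \<Rightarrow> ('v \<Rightarrow> 'v) \<Rightarrow> ('v \<Rightarrow> 'v \<Rightarrow> real) \<Rightarrow>
     ('v \<Rightarrow> 'v \<Rightarrow> 'v \<Rightarrow> real) \<Rightarrow> ('v \<Rightarrow> real) \<Rightarrow> bool"
  where
    "class_condition W0 n V J g F \<theta> \<longleftrightarrow>
       (\<forall>x\<in>V. \<forall>y\<in>V. \<forall>z\<in>V. F x y z = 0)"
  | "class_condition W1 n V J g F \<theta> \<longleftrightarrow>
       (\<forall>x\<in>V. \<forall>y\<in>V. \<forall>z\<in>V. F x y z = 1 / (2 * real n) *
          (g x y * \<theta> z + g (J x) y * \<theta> (J z) + g x z * \<theta> y + g (J x) z * \<theta> (J y)))"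
  | "class_condition W2 n V J g F \<theta> \<longleftrightarrow>
       (\<forall>x\<in>V. \<forall>y\<in>V. \<forall>z\<in>V. cyclic_sum (\<lambda>x y z. F x y (J z)) x y z = 0) \<and>
       (\<forall>z\<in>V. \<theta> z = 0)"
  | "class_condition W3 n V J g F \<theta> \<longleftrightarrow>
       (\<forall>x\<in>V. \<forall>y\<in>V. \<forall>z\<in>V. cyclic_sum F x y z = 0)"
  | "class_condition W1_W2 n V J g F \<theta> \<longleftrightarrow>
       (\<forall>x\<in>V. \<forall>y\<in>V. \<forall>z\<in>V. cyclic_sum (\<lambda>x y z. F x y (J z)) x y z = 0)"
  | "class_condition W1_W3 n V J g F \<theta> \<longleftrightarrow>
       (\<forall>x\<in>V. \<forall>y\<in>V. \<forall>z\<in>V. cyclic_sum F x y z =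
          1 / real n * cyclic_sum (\<lambda>x y z. g x y * \<theta> z + g (J x) y * \<theta> (J z)) x y z)"
  | "class_condition W2_W3 n V J g F \<theta> \<longleftrightarrow> (\<forall>z\<in>V. \<theta> z = 0)"
  | "class_condition W1_W2_W3 n V J g F \<theta> \<longleftrightarrow> True"

text \<open>Membership of \<open>(M, J, g)\<close>; the argument \<open>D\<close> is meant to be the Levi-Civita connection of \<open>g\<close>.\<close>

definition belongs_to_class ::
    "norden_class \<Rightarrow> nat \<Rightarrow> ('m, 'e::euclidean_space) mfd \<Rightarrow> ('m, 'e) endo_field \<Rightarrow>
     ('m, 'e) bilin_field \<Rightarrow> ('m, 'e) connection \<Rightarrow> bool"
  where "belongs_to_class W n M J g D \<longleftrightarrow>
    (\<forall>p\<in>points M. class_condition W n (tangent_space M p) (J p) (g p)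
       (F_tensor M J g D p) (theta_form M J g D p))"

end

theory Submission
  imports Defs
begin

text \<open>
  Membership in each class is a condition on the algebraic data \<open>(J, g, F, \<theta>)\<close> in every tangent
  space, so the theorem follows once the data \<open>(J, g', F', \<theta>')\<close> of the twin manifold, with
  \<open>g'(x, y) = g(J x, y)\<close>, are known in terms of those of the original one.

  The tensor \<open>F(x, y, z) = g((D\<^sub>x J) y, z)\<close> is the covariant derivative \<open>(D\<^sub>x g')(y, z)\<close>. Since
  \<open>D' g' = 0\<close> and both connections are torsion-free, a Koszul formula expresses the difference
  \<open>D' - D\<close>, and with it \<open>F'\<close>, through \<open>F\<close> alone (\<open>F_tensor_twin\<close>):
  \<open>2 F'(x, y, z) = F(J y, z, x) - F(y, J z, x) + F(J z, x, y) - F(z, x, J y)\<close>.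
  The trace of this identity yields \<open>\<theta>' = \<theta>\<close> (\<open>trace_twin\<close>, \<open>theta_form_twin\<close>).

  It remains to see that the passage \<open>(g, F, \<theta>) \<mapsto> (g', F', \<theta>)\<close> preserves the class conditions. It
  is linear in \<open>F\<close>, maps the right-hand side of the condition for \<open>W1\<close> to the one for \<open>g'\<close>, and
  transforms the two cyclic sums that occur into cyclic sums of the same kind
  (\<open>class_condition_twin\<close>). Performed twice it is \<open>(g, F, \<theta>) \<mapsto> (-g, -F, \<theta>)\<close>, and the conditions are
  insensitive to this sign (\<open>class_condition_negate\<close>), so the converse implication is the same
  statement applied to the twin.

  All this is computed with vector fields that extend given tangent vectors. Their existence
  (\<open>tangent_vector_extends\<close>) is where the smooth structure enters, through the chain rule for
  \<open>C\<^sup>k\<close> maps. That \<open>D\<^sub>x J\<close> depends on the value of a field only is not proved with frames, but from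
  the symmetry of \<open>F\<close> in its last two arguments (\<open>nabla_J_field_tensorial\<close>). The traces are computed
  with the dual vectors \<open>d a\<close> of a basis, \<open>g(d a, b) = \<delta>\<^sub>a\<^sub>b\<close>; the dual vectors for \<open>g'\<close> are \<open>- J (d a)\<close>.
\<close>

section \<open>Calculus of \<open>C\<^sup>k\<close> maps\<close>

lemma frechet_derivative_cong_open:
  assumes "open S" "x \<in> S" "\<And>y. y \<in> S \<Longrightarrow> f y = h y"
  shows "frechet_derivative f (at x) = frechet_derivative h (at x)"
proof -
  have "(f has_derivative d) (at x) \<longleftrightarrow> (h has_derivative d) (at x)" for d
    using assms by (metis has_derivative_transform_within_open)
  then show ?thesis by (simp add: frechet_derivative_def)
qed

lemma frechet_derivative_apply:
  "(f has_derivative f') (at x) \<Longrightarrow> frechet_derivative f (at x) v = f' v"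
  using frechet_derivative_at by metis

lemma differentiable_cong_open:
  assumes "open S" "x \<in> S" "\<And>y. y \<in> S \<Longrightarrow> f y = h y"
  shows "f differentiable (at x) \<longleftrightarrow> h differentiable (at x)"
  using assms unfolding differentiable_def by (metis has_derivative_transform_within_open)

lemma Ck_on_cong:
  assumes "open S" "\<And>y. y \<in> S \<Longrightarrow> f y = h y"
  shows "Ck_on k S f \<longleftrightarrow> Ck_on k S h"
  using assms(2)
proof (induction k arbitrary: f h)
  case 0
  then show ?case using continuous_on_cong by auto
next
  case (Suc k)
  have 1: "f differentiable (at x) \<longleftrightarrow> h differentiable (at x)" if "x \<in> S" for x
    using differentiable_cong_open[OF assms(1) that] Suc.prems by blast
  have 2: "frechet_derivative f (at x) v = frechet_derivative h (at x) v" if "x \<in> S" for x v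
    using frechet_derivative_cong_open[OF assms(1) that] Suc.prems by metis
  have "Ck_on k S (\<lambda>x. frechet_derivative f (at x) v) = Ck_on k S (\<lambda>x. frechet_derivative h (at x) v)" for v
    by (rule Suc.IH) (rule 2)
  with 1 show ?case by simp
qed

lemma Ck_on_subset: "Ck_on k S f \<Longrightarrow> T \<subseteq> S \<Longrightarrow> Ck_on k T f"
  by (induction k arbitrary: f) (auto intro: continuous_on_subset)

lemma Ck_on_Suc_imp: "Ck_on (Suc k) S f \<Longrightarrow> Ck_on k S f"
proof (induction k arbitrary: f)
  case 0
  then have "\<forall>x\<in>S. isCont f x"
    using differentiable_imp_continuous_within by auto
  then show ?case by (simp add: continuous_at_imp_continuous_on)
next
  case (Suc k)
  then show ?case by (metis Ck_on.simps(2))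
qed

lemma Ck_on_const: "Ck_on k S (\<lambda>x. a)"
  by (induction k arbitrary: a) (simp_all add: frechet_derivative_const)

lemma Ck_on_bounded_linear:
  assumes "open S" "bounded_linear L" "Ck_on k S f"
  shows "Ck_on k S (\<lambda>x. L (f x))"
  using assms(3)
proof (induction k arbitrary: f)
  case 0
  then show ?case
    using assms(2) by (simp add: bounded_linear.continuous_on)
next
  case (Suc k)
  have d: "((\<lambda>x. L (f x)) has_derivative (\<lambda>v. L (frechet_derivative f (at x) v))) (at x)" if "x \<in> S" for x
    using Suc.prems that
    by (auto intro!: bounded_linear.has_derivative[OF assms(2)] frechet_derivative_works[THEN iffD1])
  have "Ck_on k S (\<lambda>x. frechet_derivative (\<lambda>x. L (f x)) (at x) v)" for v
  proof -
    have "Ck_on k S (\<lambda>x. L (frechet_derivative f (at x) v))"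
      using Suc by simp
    then show ?thesis
      using Ck_on_cong[OF assms(1), of "\<lambda>x. frechet_derivative (\<lambda>x. L (f x)) (at x) v"
          "\<lambda>x. L (frechet_derivative f (at x) v)"] frechet_derivative_apply[OF d] by blast
  qed
  then show ?case using d by (auto simp: differentiable_def)
qed

lemma Ck_on_add:
  assumes "open S" "Ck_on k S f" "Ck_on k S h"
  shows "Ck_on k S (\<lambda>x. f x + h x)"
  using assms(2,3)
proof (induction k arbitrary: f h)
  case 0
  then show ?case by (simp add: continuous_on_add)
next
  case (Suc k)
  have d: "((\<lambda>x. f x + h x) has_derivative
      (\<lambda>v. frechet_derivative f (at x) v + frechet_derivative h (at x) v)) (at x)" if "x \<in> S" for x
    using Suc.prems that by (auto intro!: has_derivative_add frechet_derivative_works[THEN iffD1])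
  have "Ck_on k S (\<lambda>x. frechet_derivative (\<lambda>x. f x + h x) (at x) v)" for v
  proof -
    have "Ck_on k S (\<lambda>x. frechet_derivative f (at x) v + frechet_derivative h (at x) v)"
      using Suc by simp
    then show ?thesis
      using Ck_on_cong[OF assms(1), of "\<lambda>x. frechet_derivative (\<lambda>x. f x + h x) (at x) v"
          "\<lambda>x. frechet_derivative f (at x) v + frechet_derivative h (at x) v"]
        frechet_derivative_apply[OF d] by blast
  qed
  then show ?case using d by (auto simp: differentiable_def)
qed

lemma Ck_on_sum:
  assumes "open S" "\<And>i. i \<in> I \<Longrightarrow> Ck_on k S (f i)"
  shows "Ck_on k S (\<lambda>x. \<Sum>i\<in>I. f i x)"
  using assms(2)
  by (induction I rule: infinite_finite_induct) (auto simp: Ck_on_const intro: Ck_on_add[OF assms(1)])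

lemma Ck_on_scaleR:
  assumes "open S" "Ck_on k S f" "Ck_on k S h"
  shows "Ck_on k S (\<lambda>x. f x *\<^sub>R h x)"
  using assms(2,3)
proof (induction k arbitrary: f h)
  case 0
  then show ?case by (simp add: continuous_on_scaleR)
next
  case (Suc k)
  have d: "((\<lambda>x. f x *\<^sub>R h x) has_derivative
      (\<lambda>v. f x *\<^sub>R frechet_derivative h (at x) v + frechet_derivative f (at x) v *\<^sub>R h x)) (at x)"
    if "x \<in> S" for x
    using Suc.prems that by (auto intro!: has_derivative_scaleR frechet_derivative_works[THEN iffD1])
  have "Ck_on k S (\<lambda>x. frechet_derivative (\<lambda>x. f x *\<^sub>R h x) (at x) v)" for v
  proof -
    have "Ck_on k S (\<lambda>x. f x *\<^sub>R frechet_derivative h (at x) v + frechet_derivative f (at x) v *\<^sub>R h x)"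
      using Suc.prems Ck_on_Suc_imp[OF Suc.prems(1)] Ck_on_Suc_imp[OF Suc.prems(2)]
      by (auto intro!: Ck_on_add[OF assms(1)] Suc.IH)
    then show ?thesis
      using Ck_on_cong[OF assms(1), of "\<lambda>x. frechet_derivative (\<lambda>x. f x *\<^sub>R h x) (at x) v"
          "\<lambda>x. f x *\<^sub>R frechet_derivative h (at x) v + frechet_derivative f (at x) v *\<^sub>R h x"]
        frechet_derivative_apply[OF d] by blast
  qed
  then show ?case using d by (auto simp: differentiable_def)
qed

text \<open>
  Expanding in a basis turns the chain rule into the sum of products
  \<open>(\<partial>\<^sub>v h \<bullet> b) (\<partial>\<^sub>b f \<circ> h)\<close>. Each factor is one order less smooth, so the closure properties above
  and the induction hypothesis for \<open>\<partial>\<^sub>b f\<close> apply.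
\<close>

lemma Ck_on_compose:
  fixes h :: "'a::euclidean_space \<Rightarrow> 'b::euclidean_space" and f :: "'b \<Rightarrow> 'c::real_normed_vector"
  assumes "open S" "h ` S \<subseteq> T" "Ck_on k S h" "Ck_on k T f"
  shows "Ck_on k S (\<lambda>x. f (h x))"
  using assms(3,4)
proof (induction k arbitrary: f)
  case 0
  then show ?case using assms(2) by (auto intro: continuous_on_compose2)
next
  case (Suc k)
  let ?e = "\<lambda>x v. \<Sum>b\<in>Basis. (frechet_derivative h (at x) v \<bullet> b) *\<^sub>R frechet_derivative f (at (h x)) b"
  have c: "((\<lambda>x. f (h x)) has_derivative
      (\<lambda>v. frechet_derivative f (at (h x)) (frechet_derivative h (at x) v))) (at x)"
    and l: "linear (frechet_derivative f (at (h x)))" if "x \<in> S" for x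
  proof -
    have f: "(f has_derivative frechet_derivative f (at (h x))) (at (h x))"
      and h: "(h has_derivative frechet_derivative h (at x)) (at x)"
      using Suc.prems that assms(2) by (auto intro!: frechet_derivative_works[THEN iffD1])
    show "((\<lambda>x. f (h x)) has_derivative
      (\<lambda>v. frechet_derivative f (at (h x)) (frechet_derivative h (at x) v))) (at x)"
      by (rule has_derivative_compose[OF h f])
    show "linear (frechet_derivative f (at (h x)))"
      using f by (rule has_derivative_linear)
  qed
  have e: "frechet_derivative (\<lambda>x. f (h x)) (at x) v = ?e x v" if "x \<in> S" for x v
  proof -
    let ?w = "frechet_derivative h (at x) v"
    have "frechet_derivative (\<lambda>x. f (h x)) (at x) v
        = frechet_derivative f (at (h x)) (\<Sum>b\<in>Basis. (?w \<bullet> b) *\<^sub>R b)"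
      using frechet_derivative_apply[OF c[OF that]] by (simp add: euclidean_representation)
    also have "\<dots> = ?e x v"
      using l[OF that] by (simp add: linear_sum linear_scale)
    finally show ?thesis .
  qed
  have "Ck_on k S (\<lambda>x. frechet_derivative (\<lambda>x. f (h x)) (at x) v)" for v
  proof -
    have "Ck_on k S (\<lambda>x. ?e x v)"
    proof (intro Ck_on_sum Ck_on_scaleR assms(1))
      fix b :: 'b
      show "Ck_on k S (\<lambda>x. frechet_derivative h (at x) v \<bullet> b)"
        using Suc.prems by (intro Ck_on_bounded_linear[OF assms(1) bounded_linear_inner_left]) auto
      show "Ck_on k S (\<lambda>x. frechet_derivative f (at (h x)) b)"
        using Suc.prems Ck_on_Suc_imp[OF Suc.prems(1)] by (intro Suc.IH) auto
    qed
    then show ?thesis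
      using Ck_on_cong[OF assms(1), of "\<lambda>x. frechet_derivative (\<lambda>x. f (h x)) (at x) v" "\<lambda>x. ?e x v"] e
      by blast
  qed
  then show ?case using c by (auto simp: differentiable_def)
qed

section \<open>Tangent vectors and their extensions\<close>

locale manifold =
  fixes M :: "('m, 'e::euclidean_space) mfd"
  assumes smooth_manifold: "smooth_manifold M"
begin

lemma chart_at_exists: "p \<in> points M \<Longrightarrow> \<exists>c. c \<in> charts_at M p"
  using smooth_manifold unfolding smooth_manifold_def charts_at_def by blast

lemma openin_chart_dom: "c \<in> atlas M \<Longrightarrow> openin (top_of M) (chart_dom c)"
  using smooth_manifold unfolding smooth_manifold_def by blast

lemma chart_dom_subset: "c \<in> atlas M \<Longrightarrow> chart_dom c \<subseteq> points M"
  using openin_chart_dom openin_subset by blast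

lemma coord_homeomorphic:
  "c \<in> atlas M \<Longrightarrow> homeomorphic_map (subtopology (top_of M) (chart_dom c))
     (top_of_set (coord c ` chart_dom c)) (coord c)"
  using smooth_manifold unfolding smooth_manifold_def by blast

lemma inj_on_coord: "c \<in> atlas M \<Longrightarrow> inj_on (coord c) (chart_dom c)"
  using homeomorphic_imp_injective_map[OF coord_homeomorphic] chart_dom_subset
  by (metis topspace_subtopology_subset)

lemma coord_inv_coord: "c \<in> atlas M \<Longrightarrow> q \<in> chart_dom c \<Longrightarrow> coord_inv c (coord c q) = q"
  unfolding coord_inv_def using inj_on_coord by simp

lemma open_coord_image:
  assumes "c \<in> atlas M" "openin (top_of M) U"
  shows "open (coord c ` (U \<inter> chart_dom c))"
proof -
  have "openin (subtopology (top_of M) (chart_dom c)) (U \<inter> chart_dom c)"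
    using assms(2) by (auto simp: openin_subtopology)
  then have "openin (top_of_set (coord c ` chart_dom c)) (coord c ` (U \<inter> chart_dom c))"
    using homeomorphic_imp_open_map[OF coord_homeomorphic[OF assms(1)]] by (simp add: open_map_def)
  moreover have "open (coord c ` chart_dom c)"
    using smooth_manifold assms(1) unfolding smooth_manifold_def by blast
  ultimately show ?thesis by (metis openin_open_eq)
qed

lemma open_coord_chart_dom: "c \<in> atlas M \<Longrightarrow> c' \<in> atlas M \<Longrightarrow> open (coord c ` (chart_dom c \<inter> chart_dom c'))"
  using open_coord_image[OF _ openin_chart_dom, of c c'] by (simp add: Int_commute)

lemma Ck_on_transition:
  "c \<in> atlas M \<Longrightarrow> c' \<in> atlas M \<Longrightarrow>
     Ck_on k (coord c ` (chart_dom c \<inter> chart_dom c')) (coord c' \<circ> coord_inv c)"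
  using smooth_manifold unfolding smooth_manifold_def smooth_on_def by blast

lemma transition_has_derivative:
  assumes "c \<in> charts_at M q" "c' \<in> charts_at M q"
  shows "((coord c' \<circ> coord_inv c) has_derivative
      frechet_derivative (coord c' \<circ> coord_inv c) (at (coord c q))) (at (coord c q))"
proof -
  have "(coord c' \<circ> coord_inv c) differentiable (at (coord c q))"
    using Ck_on_transition[of c c' 1] assms by (auto simp: charts_at_def)
  then show ?thesis by (simp add: frechet_derivative_works)
qed

lemma linear_transition_derivative:
  "c \<in> charts_at M q \<Longrightarrow> c' \<in> charts_at M q \<Longrightarrow>
    linear (frechet_derivative (coord c' \<circ> coord_inv c) (at (coord c q)))"
  using transition_has_derivative has_derivative_linear by blast

lemma transition_derivative_compose:
  assumes "c \<in> charts_at M q" "c1 \<in> charts_at M q" "c2 \<in> charts_at M q"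
  shows "frechet_derivative (coord c2 \<circ> coord_inv c) (at (coord c q)) v =
    frechet_derivative (coord c2 \<circ> coord_inv c1) (at (coord c1 q))
      (frechet_derivative (coord c1 \<circ> coord_inv c) (at (coord c q)) v)"
proof -
  let ?U = "chart_dom c1 \<inter> chart_dom c2"
  let ?S = "coord c ` (?U \<inter> chart_dom c)"
  have at: "c \<in> atlas M" "c1 \<in> atlas M" "c2 \<in> atlas M" "q \<in> ?U \<inter> chart_dom c"
    using assms by (auto simp: charts_at_def)
  have S: "open ?S" "coord c q \<in> ?S"
    using at by (auto intro!: open_coord_image openin_Int openin_chart_dom)
  have q: "(coord c1 \<circ> coord_inv c) (coord c q) = coord c1 q"
    using at coord_inv_coord by simp
  have "(((coord c2 \<circ> coord_inv c1) \<circ> (coord c1 \<circ> coord_inv c)) has_derivative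
     (frechet_derivative (coord c2 \<circ> coord_inv c1) (at (coord c1 q)) \<circ>
      frechet_derivative (coord c1 \<circ> coord_inv c) (at (coord c q)))) (at (coord c q))"
    using diff_chain_at[OF transition_has_derivative[OF assms(1,2)]]
      transition_has_derivative[OF assms(2,3)] q by simp
  then have "((coord c2 \<circ> coord_inv c) has_derivative
     (frechet_derivative (coord c2 \<circ> coord_inv c1) (at (coord c1 q)) \<circ>
      frechet_derivative (coord c1 \<circ> coord_inv c) (at (coord c q)))) (at (coord c q))"
    by (rule has_derivative_transform_within_open[OF _ S])
      (use coord_inv_coord[OF at(1)] coord_inv_coord[OF at(2)] in auto)
  then show ?thesis using frechet_derivative_apply by (metis comp_apply)
qed

lemma tangent_spaceI:
  assumes "\<And>c c'. c \<in> charts_at M p \<Longrightarrow> c' \<in> charts_at M p \<Longrightarrow>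
      u c' = frechet_derivative (coord c' \<circ> coord_inv c) (at (coord c p)) (u c)"
    and "\<And>c. c \<notin> charts_at M p \<Longrightarrow> u c = 0"
  shows "u \<in> tangent_space M p"
  unfolding tangent_space_def using assms by blast

lemma tangent_space_transition:
  "u \<in> tangent_space M p \<Longrightarrow> c \<in> charts_at M p \<Longrightarrow> c' \<in> charts_at M p \<Longrightarrow>
    u c' = frechet_derivative (coord c' \<circ> coord_inv c) (at (coord c p)) (u c)"
  unfolding tangent_space_def by blast

lemma tangent_space_outside: "u \<in> tangent_space M p \<Longrightarrow> c \<notin> charts_at M p \<Longrightarrow> u c = 0"
  unfolding tangent_space_def by blast

text \<open>
  By this lemma, evaluation in one chart is a linear embedding of the tangent space into the
  model space, which bounds the size of independent sets.
\<close>

lemma tangent_space_eqI: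
  assumes "u \<in> tangent_space M p" "w \<in> tangent_space M p" "c \<in> charts_at M p" "u c = w c"
  shows "u = w"
proof
  fix c'
  show "u c' = w c'"
  proof (cases "c' \<in> charts_at M p")
    case True
    show ?thesis
      unfolding tangent_space_transition[OF assms(1,3) True]
        tangent_space_transition[OF assms(2,3) True] assms(4) ..
  next
    case False
    then show ?thesis using assms(1,2) tangent_space_outside by metis
  qed
qed

lemma subspace_tangent_space: "subspace (tangent_space M p)"
proof (rule subspaceI)
  show "0 \<in> tangent_space M p"
    by (rule tangent_spaceI) (simp_all add: linear_0 linear_transition_derivative)
next
  fix x y assume x: "x \<in> tangent_space M p" and y: "y \<in> tangent_space M p"
  show "x + y \<in> tangent_space M p"
  proof (rule tangent_spaceI)
    fix c c' assume c: "c \<in> charts_at M p" "c' \<in> charts_at M p"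
    show "(x + y) c' = frechet_derivative (coord c' \<circ> coord_inv c) (at (coord c p)) ((x + y) c)"
      unfolding plus_fun_apply linear_add[OF linear_transition_derivative[OF c]]
        tangent_space_transition[OF x c] tangent_space_transition[OF y c] ..
  qed (simp add: tangent_space_outside[OF x] tangent_space_outside[OF y])
next
  fix a :: real and x assume x: "x \<in> tangent_space M p"
  show "a *\<^sub>R x \<in> tangent_space M p"
  proof (rule tangent_spaceI)
    fix c c' assume c: "c \<in> charts_at M p" "c' \<in> charts_at M p"
    show "(a *\<^sub>R x) c' = frechet_derivative (coord c' \<circ> coord_inv c) (at (coord c p)) ((a *\<^sub>R x) c)"
      unfolding scaleR_fun_def linear_scale[OF linear_transition_derivative[OF c]]
        tangent_space_transition[OF x c] ..
  qed (simp add: scaleR_fun_def tangent_space_outside[OF x])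
qed

text \<open>
  The extension has constant components in one chart \<open>c\<close>. In another chart \<open>c'\<close> its components are
  a directional derivative of the transition map, evaluated along the inverse transition map,
  which is smooth by the chain rule for \<open>C\<^sup>k\<close> maps.
\<close>

lemma tangent_vector_extends:
  assumes "p \<in> points M" "y \<in> tangent_space M p"
  obtains Y where "Y \<in> vfs_near M p" "Y p = y"
proof -
  obtain c where c: "c \<in> charts_at M p" using chart_at_exists assms(1) by blast
  then have ca: "c \<in> atlas M" "p \<in> chart_dom c" by (auto simp: charts_at_def)
  let ?d = "\<lambda>c'. frechet_derivative (coord c' \<circ> coord_inv c)"
  define Y where "Y q = (\<lambda>c'. if c' \<in> charts_at M q then ?d c' (at (coord c q)) (y c) else 0)" for q
  have Y: "smooth_vf M (chart_dom c) Y"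
    unfolding smooth_vf_def
  proof (intro conjI ballI)
    show "openin (top_of M) (chart_dom c)" using ca openin_chart_dom by blast
  next
    fix q assume "q \<in> chart_dom c"
    then have cq: "c \<in> charts_at M q" using ca by (simp add: charts_at_def)
    show "Y q \<in> tangent_space M q"
    proof (rule tangent_spaceI)
      fix c1 c2 assume c1: "c1 \<in> charts_at M q" and c2: "c2 \<in> charts_at M q"
      show "Y q c2 = frechet_derivative (coord c2 \<circ> coord_inv c1) (at (coord c1 q)) (Y q c1)"
        unfolding Y_def using transition_derivative_compose[OF cq c1 c2, of "y c"]
        by (simp only: c1 c2 if_True)
    qed (simp add: Y_def)
  next
    fix c' assume c': "c' \<in> atlas M"
    let ?S = "coord c' ` (chart_dom c \<inter> chart_dom c')"
    let ?T = "coord c ` (chart_dom c \<inter> chart_dom c')"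
    have S: "open ?S" using open_coord_chart_dom[OF c' ca(1)] by (simp add: Int_commute)
    have e: "Y (coord_inv c' w) c' = ?d c' (at ((coord c \<circ> coord_inv c') w)) (y c)" if "w \<in> ?S" for w
      using that c' coord_inv_coord[OF c'] by (auto simp: Y_def charts_at_def)
    have im: "(coord c \<circ> coord_inv c') ` ?S \<subseteq> ?T"
      using coord_inv_coord[OF c'] by auto
    have "Ck_on k ?S (\<lambda>w. Y (coord_inv c' w) c')" for k
    proof -
      have "Ck_on k ?T (\<lambda>x. ?d c' (at x) (y c))"
        using Ck_on_transition[OF ca(1) c', of "Suc k"] by simp
      moreover have "Ck_on k ?S (coord c \<circ> coord_inv c')"
        using Ck_on_transition[OF c' ca(1), of k] by (simp add: Int_commute)
      ultimately have "Ck_on k ?S (\<lambda>w. ?d c' (at ((coord c \<circ> coord_inv c') w)) (y c))"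
        using Ck_on_compose[OF S im] by blast
      then show ?thesis
        using Ck_on_cong[OF S, of "\<lambda>w. Y (coord_inv c' w) c'"
            "\<lambda>w. ?d c' (at ((coord c \<circ> coord_inv c') w)) (y c)" k, OF e] by (simp only:)
    qed
    then show "smooth_on ?S (\<lambda>w. Y (coord_inv c' w) c')" by (simp add: smooth_on_def)
  qed
  have "Y p c = y c"
    using tangent_space_transition[OF assms(2) c c] c by (simp add: Y_def)
  moreover have "Y p \<in> tangent_space M p"
    using Y ca(2) by (simp add: smooth_vf_def)
  ultimately have "Y p = y"
    using tangent_space_eqI assms(2) c by blast
  then show ?thesis using that Y ca(2) unfolding vfs_near_def by blast
qed

lemma smooth_vf_scaleR:
  assumes "smooth_vf M U X"
  shows "smooth_vf M U (\<lambda>q. a *\<^sub>R X q)"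
  unfolding smooth_vf_def
proof (intro conjI ballI)
  show U: "openin (top_of M) U" using assms by (simp add: smooth_vf_def)
  show "a *\<^sub>R X q \<in> tangent_space M q" if "q \<in> U" for q
    using assms that subspace_scale[OF subspace_tangent_space] by (simp add: smooth_vf_def)
  fix c assume c: "c \<in> atlas M"
  have "Ck_on k (coord c ` (U \<inter> chart_dom c)) (\<lambda>v. a *\<^sub>R X (coord_inv c v) c)" for k
    using assms by (intro Ck_on_bounded_linear[OF open_coord_image[OF c U] bounded_linear_scaleR_right])
      (simp add: smooth_vf_def smooth_on_def c)
  then show "smooth_on (coord c ` (U \<inter> chart_dom c)) (\<lambda>v. (a *\<^sub>R X (coord_inv c v)) c)"
    by (simp add: smooth_on_def scaleR_fun_def)
qed

lemma const_in_funs_near: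
  assumes "p \<in> points M"
  shows "(\<lambda>q. a) \<in> funs_near M p"
  using assms unfolding funs_near_def smooth_fun_def smooth_on_def comp_def
  by (auto simp: Ck_on_const intro!: exI[of _ "points M"])

lemma deriv_along_const: "deriv_along M p x (\<lambda>q. a) = 0"
  by (simp add: deriv_along_def comp_def frechet_derivative_const)

lemma deriv_along_cong:
  assumes "p \<in> U" "openin (top_of M) U" "\<And>q. q \<in> U \<Longrightarrow> f q = h q"
  shows "deriv_along M p x f = deriv_along M p x h"
proof -
  define c where "c = (SOME c. c \<in> charts_at M p)"
  have "p \<in> points M" using assms(1,2) openin_subset by blast
  then have "c \<in> charts_at M p" unfolding c_def using chart_at_exists someI_ex by metis
  then have c: "c \<in> atlas M" "p \<in> chart_dom c" by (auto simp: charts_at_def)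
  have "frechet_derivative (f \<circ> coord_inv c) (at (coord c p)) =
      frechet_derivative (h \<circ> coord_inv c) (at (coord c p))"
    using assms(1,3) c coord_inv_coord[OF c(1)]
    by (intro frechet_derivative_cong_open[OF open_coord_image[OF c(1) assms(2)]]) auto
  then show ?thesis by (simp add: deriv_along_def c_def)
qed

lemma tangent_basis_exists: "\<exists>B. tangent_basis M p B"
proof -
  obtain B where "B \<subseteq> tangent_space M p" "independent B" "tangent_space M p \<subseteq> span B"
    using maximal_independent_subset by blast
  then show ?thesis
    unfolding tangent_basis_def using span_minimal[OF _ subspace_tangent_space] by blast
qed

lemma finite_tangent_basis:
  assumes "p \<in> points M" "tangent_basis M p B"
  shows "finite B"
proof -
  obtain c where c: "c \<in> charts_at M p" using chart_at_exists assms(1) by blast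
  have lin: "linear (\<lambda>u::('m, 'e) tvec. u c)"
    by (rule linearI) (simp_all add: scaleR_fun_def)
  have "inj_on (\<lambda>u. u c) (tangent_space M p)"
    using tangent_space_eqI[OF _ _ c] by (intro inj_onI)
  then have inj: "inj_on (\<lambda>u. u c) (span B)" and B: "independent B"
    using assms(2) by (auto simp: tangent_basis_def)
  have "independent ((\<lambda>u. u c) ` B)"
    using lin B inj by (rule linear_independent_injective_image)
  then have "finite ((\<lambda>u. u c) ` B)" by (rule independent_imp_finite)
  then show ?thesis
    using finite_imageD inj_on_subset[OF inj span_superset] by blast
qed

end

text \<open>
  Tensors at a point are constrained on the tangent space only, so the linearity that is
  available is linearity on a subspace, not that of \<^const>\<open>linear\<close>.
\<close>

lemma linear_on_subspace_sum:
  fixes f :: "'v::real_vector \<Rightarrow> 'w::real_vector"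
  assumes "subspace V"
    and f: "\<And>x y a b. x \<in> V \<Longrightarrow> y \<in> V \<Longrightarrow> f (a *\<^sub>R x + b *\<^sub>R y) = a *\<^sub>R f x + b *\<^sub>R f y"
    and "\<And>i. i \<in> I \<Longrightarrow> v i \<in> V"
  shows "f (\<Sum>i\<in>I. c i *\<^sub>R v i) = (\<Sum>i\<in>I. c i *\<^sub>R f (v i))"
proof -
  have z: "f 0 = 0" using f[of 0 0 0 0] subspace_0[OF assms(1)] by simp
  from assms(3) show ?thesis
  proof (induction I rule: infinite_finite_induct)
    case (insert i I)
    have "(\<Sum>i\<in>I. c i *\<^sub>R v i) \<in> V"
      using insert.prems assms(1) by (intro subspace_sum subspace_scale) auto
    then have "f (c i *\<^sub>R v i + 1 *\<^sub>R (\<Sum>i\<in>I. c i *\<^sub>R v i)) = c i *\<^sub>R f (v i) + 1 *\<^sub>R f (\<Sum>i\<in>I. c i *\<^sub>R v i)"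
      using insert.prems by (intro f) auto
    with insert show ?case by simp
  qed (simp_all add: z)
qed

section \<open>Dual families and traces of bilinear forms\<close>

locale nondegenerate_form =
  fixes V :: "'v::real_vector set" and g :: "'v \<Rightarrow> 'v \<Rightarrow> real"
  assumes subspace: "subspace V"
    and g_sym: "x \<in> V \<Longrightarrow> y \<in> V \<Longrightarrow> g x y = g y x"
    and g_linear: "x \<in> V \<Longrightarrow> y \<in> V \<Longrightarrow> z \<in> V \<Longrightarrow> g (a *\<^sub>R x + b *\<^sub>R y) z = a * g x z + b * g y z"
    and g_nondegenerate: "x \<in> V \<Longrightarrow> (\<And>y. y \<in> V \<Longrightarrow> g x y = 0) \<Longrightarrow> x = 0"
begin

lemma g_add: "x \<in> V \<Longrightarrow> y \<in> V \<Longrightarrow> z \<in> V \<Longrightarrow> g (x + y) z = g x z + g y z"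
  using g_linear[of x y z 1 1] by simp

lemma g_diff: "x \<in> V \<Longrightarrow> y \<in> V \<Longrightarrow> z \<in> V \<Longrightarrow> g (x - y) z = g x z - g y z"
  using g_linear[of x y z 1 "-1"] by simp

lemma g_minus: "x \<in> V \<Longrightarrow> z \<in> V \<Longrightarrow> g (- x) z = - g x z"
  using g_linear[of x x z "-1" 0] by simp

lemma g_minus_right: "x \<in> V \<Longrightarrow> z \<in> V \<Longrightarrow> g x (- z) = - g x z"
  using g_minus[of z x] g_sym subspace_neg[OF subspace] by metis

lemma g_sum:
  assumes "\<And>i. i \<in> I \<Longrightarrow> v i \<in> V" "z \<in> V"
  shows "g (\<Sum>i\<in>I. c i *\<^sub>R v i) z = (\<Sum>i\<in>I. c i * g (v i) z)"
  using linear_on_subspace_sum[OF subspace, of "\<lambda>x. g x z" I v c] assms g_linear by simp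

end

text \<open>
  The family \<open>d a = \<Sum>\<^sub>b g\<^sup>a\<^sup>b b\<close>. It turns a contraction with the inverse matrix of \<open>g\<close> into
  the single sum \<open>\<Sum>\<^sub>a T(a, d a)\<close>.
\<close>

definition dual_family :: "'v set \<Rightarrow> ('v \<Rightarrow> 'v \<Rightarrow> real) \<Rightarrow> 'v set \<Rightarrow> ('v \<Rightarrow> 'v) \<Rightarrow> bool"
  where "dual_family V g B d \<longleftrightarrow>
    (\<forall>a\<in>B. d a \<in> V \<and> (\<forall>b\<in>B. g (d a) b = (if a = b then 1 else 0)))"

locale form_with_basis = nondegenerate_form V g for V :: "'v::real_vector set" and g +
  fixes B :: "'v set"
  assumes finite_B: "finite B" and independent_B: "independent B" and span_B: "span B = V"
begin

lemma B_in: "b \<in> B \<Longrightarrow> b \<in> V"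
  using span_B span_superset by blast

lemma basis_expansion:
  assumes "x \<in> V"
  obtains u where "x = (\<Sum>a\<in>B. u a *\<^sub>R a)"
  using assms span_B span_finite[OF finite_B] by auto

lemma zero_if_orthogonal_to_basis:
  assumes "x \<in> V" "\<And>b. b \<in> B \<Longrightarrow> g x b = 0"
  shows "x = 0"
proof (rule g_nondegenerate[OF assms(1)])
  fix y assume y: "y \<in> V"
  then obtain u where u: "y = (\<Sum>a\<in>B. u a *\<^sub>R a)" by (rule basis_expansion)
  have "g x y = g y x" using assms(1) y g_sym by blast
  also have "\<dots> = (\<Sum>a\<in>B. u a * g a x)" unfolding u using assms(1) B_in by (intro g_sum) auto
  also have "\<dots> = 0" using assms B_in g_sym by (intro sum.neutral) auto
  finally show "g x y = 0" .
qed

lemma eq_if_agree_on_basis: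
  assumes "x \<in> V" "y \<in> V" "\<And>b. b \<in> B \<Longrightarrow> g x b = g y b"
  shows "x = y"
  using zero_if_orthogonal_to_basis[of "x - y"] assms g_diff B_in subspace_diff[OF subspace] by auto

text \<open>
  The map \<open>x \<mapsto> \<Sum>\<^sub>a g(x, a) a\<close> from \<open>V\<close> to itself is injective by nondegeneracy, hence surjective
  because \<open>V\<close> is finite-dimensional. A preimage of the basis vector \<open>a\<close> serves as \<open>d a\<close>.
\<close>

lemma dual_family_exists: "\<exists>d. dual_family V g B d"
proof -
  define f where "f x = (\<Sum>a\<in>B. g x a *\<^sub>R a)" for x
  \<comment> \<open>The map is linear on \<open>V\<close> only; a globally linear \<open>h\<close> that agrees with it
    there gives access to the rank arguments.\<close>
  obtain h where h: "linear h" "\<And>b. b \<in> B \<Longrightarrow> h b = f b"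
    using linear_independent_extend[OF independent_B] by blast
  have hf: "h x = f x" if x: "x \<in> V" for x
  proof -
    obtain u where u: "x = (\<Sum>a\<in>B. u a *\<^sub>R a)" using x by (rule basis_expansion)
    have "h x = (\<Sum>b\<in>B. u b *\<^sub>R f b)"
      unfolding u using h by (simp add: linear_sum linear_scale)
    also have "\<dots> = (\<Sum>a\<in>B. (\<Sum>b\<in>B. u b * g b a) *\<^sub>R a)"
      unfolding f_def scaleR_sum_right by (subst sum.swap) (simp add: scaleR_sum_left)
    also have "\<dots> = f x"
      unfolding f_def using B_in
      by (intro sum.cong refl arg_cong2[where f = scaleR]) (simp add: u g_sum)
    finally show ?thesis .
  qed
  have coeff: "u b = 0" if "(\<Sum>a\<in>B. u a *\<^sub>R a) = 0" "b \<in> B" for u b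
    using independent_B that finite_B independentD by blast
  have inj: "inj_on h (span B)"
  proof (rule inj_onI)
    fix x y assume xy: "x \<in> span B" "y \<in> span B" "h x = h y"
    then have V: "x \<in> V" "y \<in> V" using span_B by auto
    have "(\<Sum>a\<in>B. (g x a - g y a) *\<^sub>R a) = 0"
      using hf V xy(3) unfolding f_def by (simp add: scaleR_left_diff_distrib sum_subtractf)
    then have "g x b = g y b" if "b \<in> B" for b using coeff[of "\<lambda>a. g x a - g y a" b] that by auto
    then show "x = y" using V eq_if_agree_on_basis by blast
  qed
  have ind: "independent (h ` B)"
    using h(1) independent_B inj by (rule linear_independent_injective_image)
  have card: "card (h ` B) = card B"
    using inj_on_subset[OF inj span_superset] by (rule card_image)
  have "f x \<in> V" for x
    unfolding f_def using B_in by (intro subspace_sum[OF subspace] subspace_scale[OF subspace])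
  then have sub: "h ` B \<subseteq> span B" using h(2) span_B by auto
  have "a \<in> span (h ` B)" if a: "a \<in> B" for a
  proof (rule ccontr)
    assume "a \<notin> span (h ` B)"
    then have "a \<notin> h ` B" and "independent (insert a (h ` B))"
      using ind span_base[of a "h ` B"] by (blast, simp add: independent_insert)
    moreover have "insert a (h ` B) \<subseteq> span B" using sub a span_base by blast
    ultimately show False
      using independent_span_bound[OF finite_B] card finite_B by fastforce
  qed
  then have "B \<subseteq> h ` V" using linear_span_image[OF h(1)] span_B by blast
  then have "\<exists>x\<in>V. f x = a" if "a \<in> B" for a using that hf by force
  then obtain d where d: "\<And>a. a \<in> B \<Longrightarrow> d a \<in> V" "\<And>a. a \<in> B \<Longrightarrow> f (d a) = a" by metis
  have "g (d a) b = (if a = b then 1 else 0)" if a: "a \<in> B" and b: "b \<in> B" for a b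
  proof -
    have "(\<Sum>c\<in>B. (if a = c then 1 else 0::real) *\<^sub>R c) = (\<Sum>c\<in>B. if a = c then c else 0)"
      by (intro sum.cong) auto
    then have "(\<Sum>c\<in>B. (if a = c then 1 else 0::real) *\<^sub>R c) = a"
      using a finite_B by simp
    then have "(\<Sum>c\<in>B. (g (d a) c - (if a = c then 1 else 0)) *\<^sub>R c) = 0"
      using d(2)[OF a] unfolding f_def by (simp only: scaleR_left_diff_distrib sum_subtractf diff_self)
    from coeff[OF this b] show ?thesis by simp
  qed
  with d(1) show ?thesis unfolding dual_family_def by blast
qed

context
  fixes d
  assumes d: "dual_family V g B d"
begin

lemma d_in: "a \<in> B \<Longrightarrow> d a \<in> V"
  and g_d: "a \<in> B \<Longrightarrow> b \<in> B \<Longrightarrow> g (d a) b = (if a = b then 1 else 0)"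
  using d by (auto simp: dual_family_def)

lemma dual_expansion:
  assumes "x \<in> V"
  shows "x = (\<Sum>a\<in>B. g x a *\<^sub>R d a)"
proof (rule eq_if_agree_on_basis[OF assms])
  show "(\<Sum>a\<in>B. g x a *\<^sub>R d a) \<in> V"
    using d_in by (intro subspace_sum[OF subspace] subspace_scale[OF subspace])
  fix b assume b: "b \<in> B"
  have "g (\<Sum>a\<in>B. g x a *\<^sub>R d a) b = (\<Sum>a\<in>B. g x a * g (d a) b)"
    using d_in B_in[OF b] by (intro g_sum)
  also have "\<dots> = (\<Sum>a\<in>B. if a = b then g x a else 0)"
    using g_d b by (intro sum.cong) auto
  finally show "g x b = g (\<Sum>a\<in>B. g x a *\<^sub>R d a) b"
    using b finite_B by simp
qed

lemma basis_expansion_dual: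
  assumes "x \<in> V"
  shows "x = (\<Sum>a\<in>B. g x (d a) *\<^sub>R a)"
proof -
  obtain u where u: "x = (\<Sum>a\<in>B. u a *\<^sub>R a)" using assms by (rule basis_expansion)
  have "g x (d b) = u b" if b: "b \<in> B" for b
  proof -
    have "g x (d b) = (\<Sum>a\<in>B. u a * g a (d b))"
      unfolding u using d_in[OF b] B_in by (intro g_sum)
    also have "\<dots> = (\<Sum>a\<in>B. if a = b then u a else 0)"
      using g_d b g_sym[OF B_in d_in[OF b]] by (intro sum.cong) auto
    finally show ?thesis using b finite_B by simp
  qed
  then have "(\<Sum>a\<in>B. g x (d a) *\<^sub>R a) = (\<Sum>a\<in>B. u a *\<^sub>R a)" by simp
  with u show ?thesis by simp
qed

text \<open>
  The inverse matrix has the entries \<open>g\<^sup>a\<^sup>b = g(d a, d b)\<close>.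
\<close>

lemma inverse_matrix_exists: "\<exists>H. inverse_matrix_on B g H"
proof
  have *: "(\<Sum>c\<in>B. g (d a) (d c) * g c b) = (if a = b then 1 else 0)" if "a \<in> B" "b \<in> B" for a b
    using g_sum[of B "\<lambda>c. c" b "\<lambda>c. g (d a) (d c)"] B_in that basis_expansion_dual[OF d_in] g_d by auto
  have "(\<Sum>c\<in>B. g a c * g (d c) (d b)) = (\<Sum>c\<in>B. g (d b) (d c) * g c a)" if "a \<in> B" "b \<in> B" for a b
    using that g_sym B_in d_in by (intro sum.cong refl) (simp add: mult.commute)
  with * show "inverse_matrix_on B g (\<lambda>a b. g (d a) (d b))"
    unfolding inverse_matrix_on_def by auto
qed

text \<open>
  The vectors \<open>\<Sum>\<^sub>b H\<^sup>a\<^sup>b b\<close> satisfy the equations that define \<open>d a\<close>, so any inverse matrix yields the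
  same contraction.
\<close>

lemma trace_eq_dual:
  assumes H: "inverse_matrix_on B g H"
    and T: "\<And>a x y s t. a \<in> V \<Longrightarrow> x \<in> V \<Longrightarrow> y \<in> V \<Longrightarrow> T a (s *\<^sub>R x + t *\<^sub>R y) = s * T a x + t * T a y"
  shows "(\<Sum>a\<in>B. \<Sum>b\<in>B. H a b * T a b) = (\<Sum>a\<in>B. T a (d a))"
proof (rule sum.cong[OF refl])
  fix a assume a: "a \<in> B"
  have "(\<Sum>b\<in>B. H a b *\<^sub>R b) = d a"
  proof (rule eq_if_agree_on_basis[OF _ d_in[OF a]])
    show "(\<Sum>b\<in>B. H a b *\<^sub>R b) \<in> V"
      using B_in by (intro subspace_sum[OF subspace] subspace_scale[OF subspace])
    fix b assume "b \<in> B"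
    then show "g (\<Sum>b\<in>B. H a b *\<^sub>R b) b = g (d a) b"
      using H a B_in g_d unfolding inverse_matrix_on_def by (simp add: g_sum)
  qed
  moreover have "T a (\<Sum>b\<in>B. H a b *\<^sub>R b) = (\<Sum>b\<in>B. H a b * T a b)"
    using linear_on_subspace_sum[OF subspace, of "T a" B "\<lambda>b. b"] T B_in a by simp
  ultimately show "(\<Sum>b\<in>B. H a b * T a b) = T a (d a)" by simp
qed

lemma trace_swap:
  assumes T1: "\<And>z x y s t. z \<in> V \<Longrightarrow> x \<in> V \<Longrightarrow> y \<in> V \<Longrightarrow> T (s *\<^sub>R x + t *\<^sub>R y) z = s * T x z + t * T y z"
    and T2: "\<And>z x y s t. z \<in> V \<Longrightarrow> x \<in> V \<Longrightarrow> y \<in> V \<Longrightarrow> T z (s *\<^sub>R x + t *\<^sub>R y) = s * T z x + t * T z y"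
  shows "(\<Sum>a\<in>B. T (d a) a) = (\<Sum>a\<in>B. T a (d a))"
proof -
  have 1: "T (d a) a = (\<Sum>c\<in>B. g (d a) (d c) * T c a)" if "a \<in> B" for a
    using linear_on_subspace_sum[OF subspace, of "\<lambda>x. T x a" B "\<lambda>c. c" "\<lambda>c. g (d a) (d c)"]
      basis_expansion_dual[OF d_in[OF that]] T1 B_in that by simp
  have 2: "T a (d a) = (\<Sum>c\<in>B. g (d a) (d c) * T a c)" if "a \<in> B" for a
    using linear_on_subspace_sum[OF subspace, of "T a" B "\<lambda>c. c" "\<lambda>c. g (d a) (d c)"]
      basis_expansion_dual[OF d_in[OF that]] T2 B_in that by simp
  have "(\<Sum>a\<in>B. T (d a) a) = (\<Sum>a\<in>B. \<Sum>c\<in>B. g (d a) (d c) * T c a)" using 1 by simp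
  also have "\<dots> = (\<Sum>c\<in>B. \<Sum>a\<in>B. g (d a) (d c) * T c a)" by (rule sum.swap)
  also have "\<dots> = (\<Sum>c\<in>B. \<Sum>a\<in>B. g (d c) (d a) * T c a)"
    using g_sym d_in by (intro sum.cong refl) auto
  also have "\<dots> = (\<Sum>c\<in>B. T c (d c))" using 2 by simp
  finally show ?thesis .
qed

text \<open>
  Both sides expand to \<open>\<Sum>\<^sub>a\<^sub>,\<^sub>c g(A a, d c) T(c, d a)\<close>: expand \<open>A a\<close> in the basis on the left, and \<open>A (d c)\<close>
  in the dual family on the right, using that \<open>A\<close> is self-adjoint.
\<close>

lemma trace_self_adjoint:
  assumes T1: "\<And>z x y s t. z \<in> V \<Longrightarrow> x \<in> V \<Longrightarrow> y \<in> V \<Longrightarrow> T (s *\<^sub>R x + t *\<^sub>R y) z = s * T x z + t * T y z"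
    and T2: "\<And>z x y s t. z \<in> V \<Longrightarrow> x \<in> V \<Longrightarrow> y \<in> V \<Longrightarrow> T z (s *\<^sub>R x + t *\<^sub>R y) = s * T z x + t * T z y"
    and A: "\<And>x. x \<in> V \<Longrightarrow> A x \<in> V" "\<And>x y. x \<in> V \<Longrightarrow> y \<in> V \<Longrightarrow> g (A x) y = g x (A y)"
  shows "(\<Sum>a\<in>B. T (A a) (d a)) = (\<Sum>a\<in>B. T a (A (d a)))"
proof -
  have 1: "T (A a) (d a) = (\<Sum>c\<in>B. g (A a) (d c) * T c (d a))" if "a \<in> B" for a
    using linear_on_subspace_sum[OF subspace, of "\<lambda>x. T x (d a)" B "\<lambda>c. c" "\<lambda>c. g (A a) (d c)"]
      basis_expansion_dual[OF A(1)[OF B_in[OF that]]] T1 B_in d_in that by simp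
  have 2: "T c (A (d c)) = (\<Sum>a\<in>B. g (A (d c)) a * T c (d a))" if "c \<in> B" for c
    using linear_on_subspace_sum[OF subspace, of "T c" B d "\<lambda>a. g (A (d c)) a"]
      dual_expansion[OF A(1)[OF d_in[OF that]]] T2 B_in d_in that by simp
  have "(\<Sum>a\<in>B. T (A a) (d a)) = (\<Sum>a\<in>B. \<Sum>c\<in>B. g (A a) (d c) * T c (d a))" using 1 by simp
  also have "\<dots> = (\<Sum>c\<in>B. \<Sum>a\<in>B. g (A a) (d c) * T c (d a))" by (rule sum.swap)
  also have "\<dots> = (\<Sum>c\<in>B. \<Sum>a\<in>B. g (A (d c)) a * T c (d a))"
  proof (intro sum.cong refl arg_cong2[where f = "(*)"])
    fix a c assume "a \<in> B" "c \<in> B"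
    then show "g (A a) (d c) = g (A (d c)) a"
      using A g_sym d_in B_in by metis
  qed
  also have "\<dots> = (\<Sum>c\<in>B. T c (A (d c)))" using 2 by simp
  finally show ?thesis .
qed

end

end

section \<open>The pointwise algebra of Norden metrics\<close>

locale norden_space = nondegenerate_form V g for V :: "'v::real_vector set" and g +
  fixes J :: "'v \<Rightarrow> 'v"
  assumes J_in: "x \<in> V \<Longrightarrow> J x \<in> V"
    and J_J: "x \<in> V \<Longrightarrow> J (J x) = - x"
    and J_linear: "x \<in> V \<Longrightarrow> y \<in> V \<Longrightarrow> J (a *\<^sub>R x + b *\<^sub>R y) = a *\<^sub>R J x + b *\<^sub>R J y"
    and g_J_J: "x \<in> V \<Longrightarrow> y \<in> V \<Longrightarrow> g (J x) (J y) = - g x y"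
begin

lemma J_minus: "x \<in> V \<Longrightarrow> J (- x) = - J x"
  using J_linear[of x x "-1" 0] by simp

lemma minus_in: "x \<in> V \<Longrightarrow> - x \<in> V"
  using subspace_neg[OF subspace] by blast

lemma J_self_adjoint:
  assumes "x \<in> V" "y \<in> V"
  shows "g (J x) y = g x (J y)"
  using g_J_J[of x "J y"] g_minus_right[of "J x" y] J_J[of y] J_in assms by simp

text \<open>
  The dual family of \<open>g\<close> determines that of the associated form, so both traces can be taken
  over the same basis and the same \<open>d\<close>.
\<close>

lemma dual_family_associated:
  assumes "dual_family V g B d" "B \<subseteq> V"
  shows "dual_family V (\<lambda>x y. g (J x) y) B (\<lambda>a. - J (d a))"
  using assms unfolding dual_family_def by (auto simp: J_in J_J J_minus minus_in)

lemma norden_space_associated: "norden_space V (\<lambda>x y. g (J x) y) J"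
proof
  show "subspace V" by (rule subspace)
  show "g (J x) y = g (J y) x" if "x \<in> V" "y \<in> V" for x y
    using that J_self_adjoint g_sym J_in by metis
  show "g (J (a *\<^sub>R x + b *\<^sub>R y)) z = a * g (J x) z + b * g (J y) z"
    if "x \<in> V" "y \<in> V" "z \<in> V" for x y z a b
    using that J_in by (simp add: J_linear g_linear)
  show "x = 0" if x: "x \<in> V" and 0: "\<And>y. y \<in> V \<Longrightarrow> g (J x) y = 0" for x
    using x 0 by (intro g_nondegenerate) (use g_minus J_J J_in J_self_adjoint in \<open>metis neg_equal_0_iff_equal\<close>)+
  show "g (J (J x)) (J y) = - g (J x) y" if "x \<in> V" "y \<in> V" for x y
    using that g_J_J J_in by blast
qed (use J_in J_J J_linear in auto)

end

text \<open>
  At a point, this is the tensor \<open>F\<close> of the associated metric expressed through the tensor \<open>F\<close> of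
  the original metric.
\<close>

definition twin_tensor :: "('v \<Rightarrow> 'v) \<Rightarrow> ('v \<Rightarrow> 'v \<Rightarrow> 'v \<Rightarrow> real) \<Rightarrow> 'v \<Rightarrow> 'v \<Rightarrow> 'v \<Rightarrow> real"
  where "twin_tensor J F x y z = (F (J y) z x - F y (J z) x + F (J z) x y - F z x (J y)) / 2"

text \<open>
  The symmetries shared by the tensors \<open>F\<close> of all almost Norden manifolds, at one point.
\<close>

locale norden_tensor = norden_space V g J for V :: "'v::real_vector set" and g J +
  fixes F :: "'v \<Rightarrow> 'v \<Rightarrow> 'v \<Rightarrow> real"
  assumes F_linear1: "x \<in> V \<Longrightarrow> y \<in> V \<Longrightarrow> z \<in> V \<Longrightarrow> w \<in> V \<Longrightarrow>
      F (a *\<^sub>R x + b *\<^sub>R y) z w = a * F x z w + b * F y z w"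
    and F_linear3: "x \<in> V \<Longrightarrow> y \<in> V \<Longrightarrow> z \<in> V \<Longrightarrow> w \<in> V \<Longrightarrow>
      F z w (a *\<^sub>R x + b *\<^sub>R y) = a * F z w x + b * F z w y"
    and F_sym: "x \<in> V \<Longrightarrow> y \<in> V \<Longrightarrow> z \<in> V \<Longrightarrow> F x y z = F x z y"
    and F_J_J: "x \<in> V \<Longrightarrow> y \<in> V \<Longrightarrow> z \<in> V \<Longrightarrow> F x (J y) (J z) = F x y z"
begin

lemma F_minus1: "x \<in> V \<Longrightarrow> y \<in> V \<Longrightarrow> z \<in> V \<Longrightarrow> F (- x) y z = - F x y z"
  using F_linear1[of x x y z "-1" 0] by simp

lemma F_minus3: "x \<in> V \<Longrightarrow> y \<in> V \<Longrightarrow> z \<in> V \<Longrightarrow> F x y (- z) = - F x y z"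
  using F_linear3[of z z x y "-1" 0] by simp

lemma F_minus2: "x \<in> V \<Longrightarrow> y \<in> V \<Longrightarrow> z \<in> V \<Longrightarrow> F x (- y) z = - F x y z"
  using F_minus3[of x z y] F_sym minus_in by metis

lemma F_linear2: "x \<in> V \<Longrightarrow> y \<in> V \<Longrightarrow> z \<in> V \<Longrightarrow> w \<in> V \<Longrightarrow>
      F z (a *\<^sub>R x + b *\<^sub>R y) w = a * F z x w + b * F z y w"
  using F_linear3[of x y z w a b] F_sym subspace_add[OF subspace] subspace_scale[OF subspace] by metis

lemma F_J_left:
  assumes "x \<in> V" "y \<in> V" "z \<in> V"
  shows "F x (J y) z = - F x y (J z)"
  using F_J_J[of x y "J z"] F_minus3[of x "J y" z] J_J assms J_in by simp

text \<open>
  Moving every \<open>J\<close> from the second slot to the third (\<open>F_J_left\<close>) and then ordering the last two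
  arguments by this lemma and \<open>F_sym\<close> is a normal form that decides the identities below.
\<close>

lemma F_J_skew: "x \<in> V \<Longrightarrow> y \<in> V \<Longrightarrow> z \<in> V \<Longrightarrow> F x y (J z) = - F x z (J y)"
  using F_J_left[of x z y] F_sym[of x "J z" y] J_in by simp

lemmas F_norm = J_in J_J J_minus minus_in F_minus1 F_minus2 F_minus3 F_J_J F_J_left

text \<open>
  Interchanging twice replaces \<open>g\<close> by \<open>-g\<close> with the same Levi-Civita connection, which changes the
  sign of \<open>F\<close>. This is the algebraic form of that fact, and it makes one implication between the
  class conditions enough.
\<close>

lemma twin_twin:
  assumes "x \<in> V" "y \<in> V" "z \<in> V"
  shows "twin_tensor J (twin_tensor J F) x y z = - F x y z"
proof -
  note order = F_sym[of _ y x] F_sym[of _ z x] F_sym[of _ z y]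
    F_J_skew[of _ y x] F_J_skew[of _ z x] F_J_skew[of _ z y]
  show ?thesis
    using assms unfolding twin_tensor_def by (simp add: F_norm order field_simps)
qed

lemma norden_tensor_twin: "norden_tensor V (\<lambda>x y. g (J x) y) J (twin_tensor J F)"
  unfolding norden_tensor_def
proof (intro conjI norden_space_associated, unfold_locales)
  show "twin_tensor J F (a *\<^sub>R x + b *\<^sub>R y) z w = a * twin_tensor J F x z w + b * twin_tensor J F y z w"
    if "x \<in> V" "y \<in> V" "z \<in> V" "w \<in> V" for x y z w a b
    using that J_in unfolding twin_tensor_def
    by (simp add: F_linear1 F_linear2 F_linear3 field_simps)
  show "twin_tensor J F z w (a *\<^sub>R x + b *\<^sub>R y) = a * twin_tensor J F z w x + b * twin_tensor J F z w y"
    if "x \<in> V" "y \<in> V" "z \<in> V" "w \<in> V" for x y z w a b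
    using that J_in unfolding twin_tensor_def
    by (simp add: F_linear1 F_linear2 F_linear3 J_linear field_simps)
  fix x y z assume V: "x \<in> V" "y \<in> V" "z \<in> V"
  note order = F_sym[of _ y x] F_sym[of _ z x] F_sym[of _ z y]
    F_J_skew[of _ y x] F_J_skew[of _ z x] F_J_skew[of _ z y]
  show "twin_tensor J F x y z = twin_tensor J F x z y"
    using V unfolding twin_tensor_def by (simp add: F_norm order field_simps)
  show "twin_tensor J F x (J y) (J z) = twin_tensor J F x y z"
    using V unfolding twin_tensor_def by (simp add: F_norm order field_simps)
qed

text \<open>
  Here \<open>a \<mapsto> - J (d a)\<close> is the dual family of the associated form, so this says that \<open>\<theta>\<close> does not
  change. Of the four traces in the sum on the left, two are equal to the trace on the right. The
  other two are \<open>tr F(J z, \<cdot>, J \<cdot>)\<close> and \<open>tr F(z, \<cdot>, \<cdot>)\<close>, and they vanish: as \<open>J\<close> is \<open>g\<close>-self-adjoint with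
  square \<open>-1\<close>, a trace is unchanged when \<open>J\<close> moves from one slot to the other and is negated when
  \<open>J\<close> is inserted into both slots, whereas \<open>F\<close> does the opposite in its last two slots.
\<close>

lemma trace_twin:
  assumes "form_with_basis V g B" "dual_family V g B d" "z \<in> V"
  shows "(\<Sum>a\<in>B. twin_tensor J F a (- J (d a)) z) = (\<Sum>a\<in>B. F a (d a) z)"
proof -
  interpret form_with_basis V g B by (rule assms(1))
  note din = d_in[OF assms(2)]
  note lin = F_linear1 F_linear2 F_linear3 J_linear subspace_add[OF subspace] subspace_scale[OF subspace] J_in
  have 1: "(\<Sum>a\<in>B. F (d a) a z) = (\<Sum>a\<in>B. F a (d a) z)"
    using trace_swap[OF assms(2), of "\<lambda>x y. F x y z"] assms(3) by (simp add: lin)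
  have "(\<Sum>a\<in>B. F (J (d a)) a (J z)) = (\<Sum>a\<in>B. F (J a) (d a) (J z))"
    using trace_swap[OF assms(2), of "\<lambda>x y. F (J x) y (J z)"] assms(3) by (simp add: lin)
  also have "\<dots> = (\<Sum>a\<in>B. F a (J (d a)) (J z))"
    using trace_self_adjoint[OF assms(2), of "\<lambda>x y. F x y (J z)" J] assms(3) J_self_adjoint by (simp add: lin)
  also have "\<dots> = (\<Sum>a\<in>B. F a (d a) z)"
    using din B_in assms(3) F_J_J by (intro sum.cong) auto
  finally have 2: "(\<Sum>a\<in>B. F (J (d a)) a (J z)) = (\<Sum>a\<in>B. F a (d a) z)" .
  have "(\<Sum>a\<in>B. F (J z) a (J (d a))) = (\<Sum>a\<in>B. F (J z) (J a) (d a))"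
    using trace_self_adjoint[OF assms(2), of "\<lambda>x y. F (J z) x y" J] assms(3) J_self_adjoint by (simp add: lin)
  also have "\<dots> = - (\<Sum>a\<in>B. F (J z) a (J (d a)))"
    unfolding sum_negf[symmetric] using din B_in assms(3) by (intro sum.cong) (simp_all add: F_J_left J_in)
  finally have 3: "(\<Sum>a\<in>B. F (J z) a (J (d a))) = 0" by simp
  have "(\<Sum>a\<in>B. F z (J (J a)) (d a)) = (\<Sum>a\<in>B. F z (J a) (J (d a)))"
    using trace_self_adjoint[OF assms(2), of "\<lambda>x y. F z (J x) y" J] assms(3) J_self_adjoint by (simp add: lin)
  moreover have "(\<Sum>a\<in>B. F z (J (J a)) (d a)) = - (\<Sum>a\<in>B. F z a (d a))"
    unfolding sum_negf[symmetric] using din B_in assms(3) by (intro sum.cong) (simp_all add: J_J F_minus2)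
  moreover have "(\<Sum>a\<in>B. F z (J a) (J (d a))) = (\<Sum>a\<in>B. F z a (d a))"
    using din B_in assms(3) F_J_J by (intro sum.cong) auto
  ultimately have 4: "(\<Sum>a\<in>B. F z a (d a)) = 0" by simp
  have "twin_tensor J F a (- J (d a)) z =
      (F (d a) a z + F (J (d a)) a (J z) - F (J z) a (J (d a)) - F z a (d a)) / 2" if "a \<in> B" for a
    using that din[OF that] B_in[OF that] assms(3) F_sym[of "d a" z a] F_sym[of "J (d a)" "J z" a]
    unfolding twin_tensor_def by (simp add: J_in J_J J_minus minus_in F_minus1 F_minus2 F_minus3)
  then have "(\<Sum>a\<in>B. twin_tensor J F a (- J (d a)) z) =
      ((\<Sum>a\<in>B. F (d a) a z) + (\<Sum>a\<in>B. F (J (d a)) a (J z)) - (\<Sum>a\<in>B. F (J z) a (J (d a)))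
        - (\<Sum>a\<in>B. F z a (d a))) / 2"
    by (simp add: sum_divide_distrib[symmetric] sum.distrib sum_subtractf del: eq_divide_eq_numeral1 divide_eq_eq_numeral1)
  also have "\<dots> = (\<Sum>a\<in>B. F a (d a) z)" using 1 2 3 4 by simp
  finally show ?thesis .
qed

text \<open>
  The cyclic sums over \<open>F\<close> and over \<open>F(\<cdot>, \<cdot>, J \<cdot>)\<close> of the twin tensor are combinations of the same cyclic
  sums of \<open>F\<close> with one argument replaced by its image under \<open>J\<close> (facts \<open>C\<close> and \<open>N'\<close>). This settles
  the classes defined by a cyclic sum, since in \<open>W1_W3\<close> the right-hand side transforms like \<open>C\<close>.
  In \<open>W1\<close> the twin tensor of the right-hand side for \<open>g\<close> is the right-hand side for the
  associated form.
\<close>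

lemma class_condition_twin:
  assumes \<theta>: "\<And>x. x \<in> V \<Longrightarrow> \<theta> (- x) = - \<theta> x"
    and W: "class_condition W n V J g F \<theta>"
  shows "class_condition W n V J (\<lambda>x y. g (J x) y) (twin_tensor J F) \<theta>"
proof -
  have g_Jx: "g (J a) b = g (J b) a" if "a \<in> V" "b \<in> V" for a b
    using that J_self_adjoint g_sym J_in by metis
  have g_JJ: "g a (J b) = g (J a) b" if "a \<in> V" "b \<in> V" for a b
    using that J_self_adjoint by simp
  note g_norm = J_in J_J J_minus minus_in \<theta> g_minus g_minus_right g_JJ
  have C: "cyclic_sum (twin_tensor J F) x y z =
      cyclic_sum F (J x) y z + cyclic_sum F x (J y) z + cyclic_sum F x y (J z)"
    if "x \<in> V" "y \<in> V" "z \<in> V" for x y z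
  proof -
    note order = F_sym[of _ y x] F_sym[of _ z x] F_sym[of _ z y]
      F_J_skew[of _ y x] F_J_skew[of _ z x] F_J_skew[of _ z y]
    show ?thesis
      using that unfolding cyclic_sum_def twin_tensor_def by (simp add: F_norm order field_simps)
  qed
  let ?N = "cyclic_sum (\<lambda>x y z. F x y (J z))"
  have N': "cyclic_sum (\<lambda>x y z. twin_tensor J F x y (J z)) x y z =
      - (?N (J x) y z + ?N (J y) z x + ?N (J z) x y)"
    if "x \<in> V" "y \<in> V" "z \<in> V" for x y z
  proof -
    note order = F_sym[of _ y x] F_sym[of _ z x] F_sym[of _ z y]
      F_J_skew[of _ y x] F_J_skew[of _ z x] F_J_skew[of _ z y]
    show ?thesis
      using that unfolding cyclic_sum_def twin_tensor_def by (simp add: F_norm order field_simps)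
  qed
  have N: "\<forall>x\<in>V. \<forall>y\<in>V. \<forall>z\<in>V. cyclic_sum (\<lambda>x y z. twin_tensor J F x y (J z)) x y z = 0"
    if "\<forall>x\<in>V. \<forall>y\<in>V. \<forall>z\<in>V. ?N x y z = 0"
    using that by (simp add: N' J_in)
  show ?thesis
  proof (cases W)
    case W0
    with W show ?thesis by (simp add: twin_tensor_def J_in)
  next
    case W1
    define c where "c = 1 / (2 * real n)"
    let ?P = "\<lambda>g x y z. c *
        (g x y * \<theta> z + g (J x) y * \<theta> (J z) + g x z * \<theta> y + g (J x) z * \<theta> (J y))"
    show ?thesis
      unfolding W1 class_condition.simps c_def[symmetric]
    proof (intro ballI)
      fix x y z assume V: "x \<in> V" "y \<in> V" "z \<in> V"
      have F: "F a b c = ?P g a b c" if "a \<in> V" "b \<in> V" "c \<in> V" for a b c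
        using W W1 that by (simp add: c_def)
      note order = g_sym[of y x] g_sym[of z x] g_sym[of z y] g_Jx[of y x] g_Jx[of z x] g_Jx[of z y]
      have "F (J y) z x - F y (J z) x + F (J z) x y - F z x (J y) =
          2 * ?P (\<lambda>x y. g (J x) y) x y z"
        using V by (simp add: F g_norm order algebra_simps)
      then show "twin_tensor J F x y z = ?P (\<lambda>x y. g (J x) y) x y z"
        unfolding twin_tensor_def by simp
    qed
  next
    case W2
    with W N show ?thesis by simp
  next
    case W3
    with W C show ?thesis by (simp add: J_in)
  next
    case W1_W2
    with W N show ?thesis by simp
  next
    case W1_W3
    let ?A = "\<lambda>g x y z. g x y * \<theta> z + g (J x) y * \<theta> (J z)"
    show ?thesis
      unfolding W1_W3 class_condition.simps
    proof (intro ballI)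
      fix x y z assume V: "x \<in> V" "y \<in> V" "z \<in> V"
      have "cyclic_sum (twin_tensor J F) x y z = 1 / real n *
          (cyclic_sum (?A g) (J x) y z + cyclic_sum (?A g) x (J y) z + cyclic_sum (?A g) x y (J z))"
        using W W1_W3 V by (simp add: C J_in distrib_left)
      also have "\<dots> = 1 / real n * cyclic_sum (?A (\<lambda>x y. g (J x) y)) x y z"
        unfolding cyclic_sum_def using V
        by (simp add: g_norm g_sym[of y x] g_sym[of z x] g_sym[of z y]
            g_Jx[of y x] g_Jx[of z x] g_Jx[of z y] algebra_simps)
      finally show "cyclic_sum (twin_tensor J F) x y z =
        1 / real n * cyclic_sum (?A (\<lambda>x y. g (J x) y)) x y z" .
    qed
  qed (use W in simp_all)
qed

text \<open>
  The condition \<open>\<theta> = 0\<close> does not involve \<open>g\<close> or \<open>F\<close>, and in every other defining equation both sides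
  are odd under a simultaneous change of sign of \<open>g\<close> and \<open>F\<close>.
\<close>

lemma class_condition_negate:
  assumes "class_condition W n V J g' F' \<theta>"
    and "\<And>x y. x \<in> V \<Longrightarrow> y \<in> V \<Longrightarrow> g' x y = - g x y"
    and "\<And>x y z. x \<in> V \<Longrightarrow> y \<in> V \<Longrightarrow> z \<in> V \<Longrightarrow> F' x y z = - F x y z"
  shows "class_condition W n V J g F \<theta>"
proof -
  define c where "c = 1 / (2 * real n)"
  have "c * (- a * s + - b * t + - a' * s' + - b' * t') = - (c * (a * s + b * t + a' * s' + b' * t'))"
    for a b s t a' b' s' t' by (simp add: algebra_simps)
  \<comment> \<open>The factor is kept opaque up to this point, so that it is not multiplied out.\<close>
  note W1_rhs = this[unfolded c_def]
  have "cyclic_sum F' x y z = - cyclic_sum F x y z"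
    and "cyclic_sum (\<lambda>x y z. F' x y (J z)) x y z = - cyclic_sum (\<lambda>x y z. F x y (J z)) x y z"
    and "cyclic_sum (\<lambda>x y z. g' x y * \<theta> z + g' (J x) y * \<theta> (J z)) x y z =
      - cyclic_sum (\<lambda>x y z. g x y * \<theta> z + g (J x) y * \<theta> (J z)) x y z"
    if "x \<in> V" "y \<in> V" "z \<in> V" for x y z
    using that by (simp_all add: cyclic_sum_def assms(2,3) J_in)
  note cyclic = this
  show ?thesis
    using assms(1) by (cases W) (simp_all add: cyclic assms(2,3) J_in W1_rhs[simplified])
qed

lemma class_condition_twin_iff:
  assumes \<theta>: "\<And>x. x \<in> V \<Longrightarrow> \<theta> (- x) = - \<theta> x"
  shows "class_condition W n V J g F \<theta> \<longleftrightarrow>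
    class_condition W n V J (\<lambda>x y. g (J x) y) (twin_tensor J F) \<theta>"
proof
  assume "class_condition W n V J g F \<theta>"
  then show "class_condition W n V J (\<lambda>x y. g (J x) y) (twin_tensor J F) \<theta>"
    using \<theta> class_condition_twin by blast
next
  interpret twin: norden_tensor V "\<lambda>x y. g (J x) y" J "twin_tensor J F"
    by (rule norden_tensor_twin)
  assume "class_condition W n V J (\<lambda>x y. g (J x) y) (twin_tensor J F) \<theta>"
  from twin.class_condition_twin[OF \<theta> this]
  show "class_condition W n V J g F \<theta>"
    by (rule class_condition_negate) (simp_all add: J_J g_minus twin_twin)
qed

end

lemma class_condition_cong:
  assumes "\<And>x. x \<in> V \<Longrightarrow> J x \<in> V"
    and "\<And>x y z. x \<in> V \<Longrightarrow> y \<in> V \<Longrightarrow> z \<in> V \<Longrightarrow> F x y z = F' x y z"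
    and "\<And>z. z \<in> V \<Longrightarrow> \<theta> z = \<theta>' z"
  shows "class_condition W n V J g F \<theta> \<longleftrightarrow> class_condition W n V J g F' \<theta>'"
  by (cases W) (simp_all add: assms cyclic_sum_def)

section \<open>The tensor \<open>F\<close> of an almost Norden manifold\<close>

locale almost_norden =
  fixes n :: nat and M :: "('m, 'e::euclidean_space) mfd"
    and J :: "('m, 'e) endo_field" and g :: "('m, 'e) bilin_field"
  assumes almost_norden_manifold: "almost_norden_manifold n M J g"

sublocale almost_norden \<subseteq> manifold M
  using almost_norden_manifold by unfold_locales (simp add: almost_norden_manifold_def)

context almost_norden
begin

lemma norden_space_at:
  assumes "p \<in> points M"
  shows "norden_space (tangent_space M p) (g p) (J p)"
proof -
  have J: "\<forall>x\<in>tangent_space M p. J p x \<in> tangent_space M p \<and> J p (J p x) = - x"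
    "\<forall>x\<in>tangent_space M p. \<forall>y\<in>tangent_space M p. \<forall>a b.
      J p (a *\<^sub>R x + b *\<^sub>R y) = a *\<^sub>R J p x + b *\<^sub>R J p y"
    using almost_norden_manifold assms
    unfolding almost_norden_manifold_def almost_complex_structure_def by blast+
  have g: "\<forall>x\<in>tangent_space M p. \<forall>y\<in>tangent_space M p. g p x y = g p y x"
    "\<forall>x\<in>tangent_space M p. \<forall>y\<in>tangent_space M p. \<forall>z\<in>tangent_space M p. \<forall>a b.
      g p (a *\<^sub>R x + b *\<^sub>R y) z = a * g p x z + b * g p y z"
    "\<forall>x\<in>tangent_space M p. (\<forall>y\<in>tangent_space M p. g p x y = 0) \<longrightarrow> x = 0"
    using almost_norden_manifold assms
    unfolding almost_norden_manifold_def pseudo_riemannian_metric_def by blast+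
  have gJ: "\<forall>x\<in>tangent_space M p. \<forall>y\<in>tangent_space M p. g p (J p x) (J p y) = - g p x y"
    using almost_norden_manifold assms unfolding almost_norden_manifold_def by blast
  show ?thesis
    by unfold_locales (simp_all add: subspace_tangent_space J g gJ)
qed

lemma J_vf: "smooth_vf M U X \<Longrightarrow> smooth_vf M U (\<lambda>q. J q (X q))"
  using almost_norden_manifold
  unfolding almost_norden_manifold_def almost_complex_structure_def by blast

lemma J_vfs_near: "X \<in> vfs_near M p \<Longrightarrow> (\<lambda>q. J q (X q)) \<in> vfs_near M p"
  unfolding vfs_near_def using J_vf by blast

lemma vfs_near_tangent: "X \<in> vfs_near M p \<Longrightarrow> X p \<in> tangent_space M p"
  unfolding vfs_near_def smooth_vf_def by blast

lemma g_smooth: "smooth_vf M U X \<Longrightarrow> smooth_vf M U Y \<Longrightarrow> smooth_fun M U (\<lambda>q. g q (X q) (Y q))"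
  using almost_norden_manifold
  unfolding almost_norden_manifold_def pseudo_riemannian_metric_def by simp

lemma vfs_near_common_domain:
  assumes "X \<in> vfs_near M p" "Y \<in> vfs_near M p"
  obtains U where "openin (top_of M) U" "p \<in> U" "U \<subseteq> points M"
    "\<And>q. q \<in> U \<Longrightarrow> X q \<in> tangent_space M q" "\<And>q. q \<in> U \<Longrightarrow> Y q \<in> tangent_space M q"
proof -
  obtain A B where "p \<in> A" "smooth_vf M A X" "p \<in> B" "smooth_vf M B Y"
    using assms unfolding vfs_near_def by blast
  then show ?thesis
    using that[of "A \<inter> B"] openin_subset[of "top_of M" "A \<inter> B"] openin_Int
    unfolding smooth_vf_def by blast
qed

lemma almost_norden_associated: "almost_norden n M J (associated_metric J g)"
proof -
  have 1: "norden_space (tangent_space M p) (associated_metric J g p) (J p)" if "p \<in> points M" for p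
    using norden_space.norden_space_associated[OF norden_space_at[OF that]]
    by (simp add: associated_metric_def)
  have "pseudo_riemannian_metric M (associated_metric J g)"
    unfolding pseudo_riemannian_metric_def
  proof (intro conjI ballI allI impI)
    fix p assume p: "p \<in> points M"
    interpret norden_space "tangent_space M p" "associated_metric J g p" "J p" by (rule 1[OF p])
    fix x assume x: "x \<in> tangent_space M p"
    {
      assume "\<forall>y\<in>tangent_space M p. associated_metric J g p x y = 0"
      then show "x = 0" using g_nondegenerate x by blast
    }
    fix y assume y: "y \<in> tangent_space M p"
    show "associated_metric J g p x y = associated_metric J g p y x" using g_sym x y .
    fix z a b assume z: "z \<in> tangent_space M p"
    show "associated_metric J g p (a *\<^sub>R x + b *\<^sub>R y) z =
        a * associated_metric J g p x z + b * associated_metric J g p y z"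
      using g_linear x y z .
  next
    fix U X Y assume "smooth_vf M U X \<and> smooth_vf M U Y"
    then show "smooth_fun M U (\<lambda>q. associated_metric J g q (X q) (Y q))"
      unfolding associated_metric_def using g_smooth J_vf by blast
  qed
  moreover have "associated_metric J g p (J p x) (J p y) = - associated_metric J g p x y"
    if "p \<in> points M" "x \<in> tangent_space M p" "y \<in> tangent_space M p" for p x y
    using norden_space.g_J_J[OF 1] that by blast
  ultimately have "almost_norden_manifold n M J (associated_metric J g)"
    using almost_norden_manifold unfolding almost_norden_manifold_def by blast
  then show ?thesis by (rule almost_norden.intro)
qed

end

locale almost_norden_connection = almost_norden n M J g
  for n :: nat and M :: "('m, 'e::euclidean_space) mfd" and J g +
  fixes D :: "('m, 'e) connection"
  assumes levi_civita: "levi_civita_connection M g D"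
begin

lemma affine: "affine_connection M D"
  using levi_civita by (simp add: levi_civita_connection_def)

lemma D_in: "p \<in> points M \<Longrightarrow> x \<in> tangent_space M p \<Longrightarrow> Y \<in> vfs_near M p \<Longrightarrow> D p x Y \<in> tangent_space M p"
  using affine by (simp add: affine_connection_def)

lemma D_linear: "p \<in> points M \<Longrightarrow> x \<in> tangent_space M p \<Longrightarrow> y \<in> tangent_space M p \<Longrightarrow>
    Y \<in> vfs_near M p \<Longrightarrow> D p (a *\<^sub>R x + b *\<^sub>R y) Y = a *\<^sub>R D p x Y + b *\<^sub>R D p y Y"
  using affine by (simp add: affine_connection_def)

lemma D_Leibniz: "p \<in> points M \<Longrightarrow> x \<in> tangent_space M p \<Longrightarrow> f \<in> funs_near M p \<Longrightarrow> Y \<in> vfs_near M p \<Longrightarrow>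
    D p x (\<lambda>q. f q *\<^sub>R Y q) = deriv_along M p x f *\<^sub>R Y p + f p *\<^sub>R D p x Y"
  using affine by (simp add: affine_connection_def)

lemma D_local:
  assumes "p \<in> points M" "x \<in> tangent_space M p" "Y \<in> vfs_near M p" "Z \<in> vfs_near M p"
    "openin (top_of M) U" "p \<in> U" "\<And>q. q \<in> U \<Longrightarrow> Y q = Z q"
  shows "D p x Y = D p x Z"
proof -
  have "\<exists>U. openin (top_of M) U \<and> p \<in> U \<and> (\<forall>q\<in>U. Y q = Z q)" using assms(5-7) by blast
  then show ?thesis using affine assms(1-4) unfolding affine_connection_def by blast
qed

lemma D_torsion_free:
  "p \<in> points M \<Longrightarrow> X \<in> vfs_near M p \<Longrightarrow> Y \<in> vfs_near M p \<Longrightarrow>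
    D p (X p) Y - D p (Y p) X = lie_bracket M X Y p"
  using levi_civita by (simp add: levi_civita_connection_def)

lemma D_metric:
  "p \<in> points M \<Longrightarrow> x \<in> tangent_space M p \<Longrightarrow> Y \<in> vfs_near M p \<Longrightarrow> Z \<in> vfs_near M p \<Longrightarrow>
    deriv_along M p x (\<lambda>q. g q (Y q) (Z q)) = g p (D p x Y) (Z p) + g p (Y p) (D p x Z)"
  using levi_civita by (simp add: levi_civita_connection_def)

text \<open>
  The covariant derivative of \<open>J\<close> before it is known to depend on the value of \<open>Y\<close> at the point
  only.
\<close>

definition nabla_J_field :: "'m \<Rightarrow> ('m, 'e) tvec \<Rightarrow> ('m \<Rightarrow> ('m, 'e) tvec) \<Rightarrow> ('m, 'e) tvec"
  where "nabla_J_field p x Y = D p x (\<lambda>q. J q (Y q)) - J p (D p x Y)"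

context
  fixes p
  assumes p: "p \<in> points M"
begin

interpretation norden_space "tangent_space M p" "g p" "J p"
  by (rule norden_space_at[OF p])

lemma nabla_J_field_in:
  "x \<in> tangent_space M p \<Longrightarrow> Y \<in> vfs_near M p \<Longrightarrow> nabla_J_field p x Y \<in> tangent_space M p"
  unfolding nabla_J_field_def
  by (intro subspace_diff[OF subspace] J_in D_in p J_vfs_near)

lemma nabla_J_field_eq_deriv:
  assumes "x \<in> tangent_space M p" "Y \<in> vfs_near M p" "Z \<in> vfs_near M p"
  shows "g p (nabla_J_field p x Y) (Z p) = deriv_along M p x (\<lambda>q. g q (J q (Y q)) (Z q))
    - g p (J p (Y p)) (D p x Z) - g p (J p (D p x Y)) (Z p)"
proof -
  have "g p (nabla_J_field p x Y) (Z p) =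
      g p (D p x (\<lambda>q. J q (Y q))) (Z p) - g p (J p (D p x Y)) (Z p)"
    unfolding nabla_J_field_def
    by (intro g_diff D_in J_in p J_vfs_near vfs_near_tangent assms)
  then show ?thesis using D_metric[OF p assms(1) J_vfs_near[OF assms(2)] assms(3)] by simp
qed

text \<open>
  By \<open>nabla_J_field_eq_deriv\<close> the left-hand side is \<open>x(g(JY, Z)) - g(JY, D\<^sub>x Z) - g(J D\<^sub>x Y, Z)\<close>, the
  derivative of the associated metric, and this is symmetric because \<open>J\<close> is \<open>g\<close>-self-adjoint.
\<close>

lemma nabla_J_field_sym:
  assumes "x \<in> tangent_space M p" "Y \<in> vfs_near M p" "Z \<in> vfs_near M p"
  shows "g p (nabla_J_field p x Y) (Z p) = g p (nabla_J_field p x Z) (Y p)"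
proof -
  obtain U where U: "openin (top_of M) U" "p \<in> U" "U \<subseteq> points M"
    "\<And>q. q \<in> U \<Longrightarrow> Y q \<in> tangent_space M q" "\<And>q. q \<in> U \<Longrightarrow> Z q \<in> tangent_space M q"
    using vfs_near_common_domain[OF assms(2,3)] by blast
  have tw: "g q (J q y) z = g q (J q z) y"
    if "q \<in> U" "y \<in> tangent_space M q" "z \<in> tangent_space M q" for q y z
  proof -
    interpret q: norden_space "tangent_space M q" "g q" "J q"
      using norden_space_at that(1) U(3) by blast
    show ?thesis using q.J_self_adjoint q.g_sym q.J_in that(2,3) by metis
  qed
  have "deriv_along M p x (\<lambda>q. g q (J q (Y q)) (Z q)) = deriv_along M p x (\<lambda>q. g q (J q (Z q)) (Y q))"
    using U tw by (intro deriv_along_cong[OF U(2,1)]) blast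
  moreover have "Y p \<in> tangent_space M p" "Z p \<in> tangent_space M p"
    "D p x Y \<in> tangent_space M p" "D p x Z \<in> tangent_space M p"
    using vfs_near_tangent D_in p assms by auto
  ultimately show ?thesis
    using assms tw[OF U(2)] by (simp add: nabla_J_field_eq_deriv)
qed

text \<open>
  No local frame is involved: one side of the symmetry relation depends on \<open>Z\<close> through its value
  at \<open>p\<close>, the other one on \<open>Y\<close> through its value at \<open>p\<close>, and every value of \<open>Z\<close> occurs because tangent
  vectors extend to vector fields.
\<close>

lemma nabla_J_field_tensorial:
  assumes "x \<in> tangent_space M p" "Y \<in> vfs_near M p" "Y' \<in> vfs_near M p" "Y p = Y' p"
  shows "nabla_J_field p x Y = nabla_J_field p x Y'"
proof -
  note in' = nabla_J_field_in[OF assms(1)]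
  have "g p (nabla_J_field p x Y - nabla_J_field p x Y') z = 0" if z: "z \<in> tangent_space M p" for z
  proof -
    obtain Z where Z: "Z \<in> vfs_near M p" "Z p = z" using tangent_vector_extends[OF p z] by blast
    have "g p (nabla_J_field p x Y) z = g p (nabla_J_field p x Y') z"
      using nabla_J_field_sym[OF assms(1) _ Z(1)] assms Z(2) by metis
    then show ?thesis using g_diff in' assms z by simp
  qed
  then have "nabla_J_field p x Y - nabla_J_field p x Y' = 0"
    using in' assms by (intro g_nondegenerate subspace_diff[OF subspace]) auto
  then show ?thesis by simp
qed

lemma F_tensor_field:
  assumes "x \<in> tangent_space M p" "Y \<in> vfs_near M p"
  shows "F_tensor M J g D p x (Y p) z = g p (nabla_J_field p x Y) z"
proof -
  define Y' where "Y' = (SOME Y'. Y' \<in> vfs_near M p \<and> Y' p = Y p)"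
  have "Y' \<in> vfs_near M p \<and> Y' p = Y p"
    unfolding Y'_def by (rule someI[of _ Y]) (use assms(2) in simp)
  then have "nabla_J_field p x Y' = nabla_J_field p x Y"
    using nabla_J_field_tensorial assms by blast
  then show ?thesis
    by (simp add: F_tensor_def nabla_J_def nabla_J_field_def Y'_def Let_def)
qed

text \<open>
  Differentiating \<open>J\<^sup>2 = -1\<close> gives \<open>(D\<^sub>x J) J = - J (D\<^sub>x J)\<close>.
\<close>

lemma nabla_J_field_J:
  assumes "x \<in> tangent_space M p" "Y \<in> vfs_near M p"
  shows "nabla_J_field p x (\<lambda>q. J q (Y q)) = - J p (nabla_J_field p x Y)"
proof -
  obtain U where U: "p \<in> U" "smooth_vf M U Y" using assms(2) unfolding vfs_near_def by blast
  have o: "openin (top_of M) U" using U(2) by (simp add: smooth_vf_def)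
  have "D p x (\<lambda>q. J q (J q (Y q))) = D p x (\<lambda>q. (-1) *\<^sub>R Y q)"
  proof (rule D_local[OF p assms(1) _ _ o U(1)])
    show "(\<lambda>q. J q (J q (Y q))) \<in> vfs_near M p" using assms(2) J_vfs_near by blast
    show "(\<lambda>q. (-1) *\<^sub>R Y q) \<in> vfs_near M p"
      unfolding vfs_near_def using U smooth_vf_scaleR by blast
    show "J q (J q (Y q)) = (-1) *\<^sub>R Y q" if "q \<in> U" for q
      using norden_space.J_J[OF norden_space_at] U(2) that openin_subset[OF o]
      by (auto simp: smooth_vf_def)
  qed
  also have "\<dots> = - D p x Y"
    using D_Leibniz[OF p assms(1) const_in_funs_near[OF p] assms(2), of "-1"]
    by (simp add: deriv_along_const)
  finally have 1: "D p x (\<lambda>q. J q (J q (Y q))) = - D p x Y" .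
  have V: "D p x Y \<in> tangent_space M p" "D p x (\<lambda>q. J q (Y q)) \<in> tangent_space M p"
    using D_in p assms J_vfs_near by auto
  have "J p (nabla_J_field p x Y) = J p (D p x (\<lambda>q. J q (Y q))) + D p x Y"
    unfolding nabla_J_field_def
    using J_linear[of "D p x (\<lambda>q. J q (Y q))" "J p (D p x Y)" 1 "-1"] V by (simp add: J_in J_J)
  then show ?thesis using 1 unfolding nabla_J_field_def by simp
qed

lemma norden_tensor_F: "norden_tensor (tangent_space M p) (g p) (J p) (F_tensor M J g D p)"
proof
  let ?V = "tangent_space M p" and ?F = "F_tensor M J g D p"
  fix x y z w a b assume V: "x \<in> ?V" "y \<in> ?V" "z \<in> ?V"
  obtain Z where Z: "Z \<in> vfs_near M p" "Z p = z" using tangent_vector_extends[OF p V(3)] by blast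
  obtain Y where Y: "Y \<in> vfs_near M p" "Y p = y" using tangent_vector_extends[OF p V(2)] by blast
  show "?F x y z = ?F x z y"
    using F_tensor_field[OF V(1) Y(1)] F_tensor_field[OF V(1) Z(1)]
      nabla_J_field_sym[OF V(1) Y(1) Z(1)] Y Z by simp
  have "?F x (J p y) (J p z) = g p (- J p (nabla_J_field p x Y)) (J p z)"
    using F_tensor_field[OF V(1) J_vfs_near[OF Y(1)]] nabla_J_field_J[OF V(1) Y(1)] Y by simp
  also have "\<dots> = g p (nabla_J_field p x Y) z"
    using nabla_J_field_in[OF V(1) Y(1)] V g_minus g_J_J J_in by simp
  finally show "?F x (J p y) (J p z) = ?F x y z"
    using F_tensor_field[OF V(1) Y(1)] Y by simp
  assume w: "w \<in> ?V"
  obtain W where W: "W \<in> vfs_near M p" "W p = w" using tangent_vector_extends[OF p w] by blast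
  have xy: "a *\<^sub>R x + b *\<^sub>R y \<in> ?V"
    using V subspace_add[OF subspace] subspace_scale[OF subspace] by blast
  have "nabla_J_field p (a *\<^sub>R x + b *\<^sub>R y) Z = a *\<^sub>R nabla_J_field p x Z + b *\<^sub>R nabla_J_field p y Z"
    unfolding nabla_J_field_def
    using V Z(1) p by (simp add: D_linear J_vfs_near J_linear D_in algebra_simps)
  then show "?F (a *\<^sub>R x + b *\<^sub>R y) z w = a * ?F x z w + b * ?F y z w"
    using F_tensor_field[OF _ Z(1)] Z(2) V xy g_linear nabla_J_field_in Z(1) w by simp
  have "g p c (a *\<^sub>R x + b *\<^sub>R y) = a * g p c x + b * g p c y" if "c \<in> ?V" for c
    using g_linear[OF V(1,2) that] g_sym that V xy by metis
  then show "?F z w (a *\<^sub>R x + b *\<^sub>R y) = a * ?F z w x + b * ?F z w y"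
    using F_tensor_field[OF V(3) W(1)] W(2) nabla_J_field_in[OF V(3) W(1)] by simp
qed

lemma form_with_basis_SOME:
  "form_with_basis (tangent_space M p) (g p) (SOME B. tangent_basis M p B)"
proof -
  have "tangent_basis M p (SOME B. tangent_basis M p B)"
    using tangent_basis_exists by (rule someI_ex)
  then show ?thesis
    using finite_tangent_basis[OF p]
    by unfold_locales (auto simp: tangent_basis_def)
qed

text \<open>
  Expresses \<open>\<theta>\<close> without the chosen inverse matrix. The chosen basis does not involve \<open>g\<close>, so it is
  the same one for the associated metric.
\<close>

lemma theta_form_dual:
  assumes "dual_family (tangent_space M p) (g p) (SOME B. tangent_basis M p B) d" "z \<in> tangent_space M p"
  shows "theta_form M J g D p z = (\<Sum>a\<in>(SOME B. tangent_basis M p B). F_tensor M J g D p a (d a) z)"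
proof -
  interpret form_with_basis "tangent_space M p" "g p" "SOME B. tangent_basis M p B"
    by (rule form_with_basis_SOME)
  interpret norden_tensor "tangent_space M p" "g p" "J p" "F_tensor M J g D p"
    by (rule norden_tensor_F)
  let ?B = "SOME B. tangent_basis M p B"
  have "inverse_matrix_on ?B (g p) (SOME H. inverse_matrix_on ?B (g p) H)"
    using inverse_matrix_exists[OF assms(1)] by (rule someI_ex)
  then show ?thesis
    using trace_eq_dual[OF assms(1), of _ "\<lambda>a b. F_tensor M J g D p a b z"] F_linear2 assms(2)
    unfolding theta_form_def Let_def by simp
qed

end

end

section \<open>The twin interchange\<close>

locale twin_connections =
  almost_norden_connection n M J g D +
  twin: almost_norden_connection n M J "associated_metric J g" D'
  for n :: nat and M :: "('m, 'e::euclidean_space) mfd" and J g D D'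
begin

definition difference :: "'m \<Rightarrow> ('m, 'e) tvec \<Rightarrow> ('m \<Rightarrow> ('m, 'e) tvec) \<Rightarrow> ('m, 'e) tvec"
  where "difference p x Y = D' p x Y - D p x Y"

context
  fixes p
  assumes p: "p \<in> points M"
begin

interpretation norden_space "tangent_space M p" "g p" "J p"
  by (rule norden_space_at[OF p])

text \<open>
  Both connections are torsion-free, so \<open>[X, Y]\<close> cancels in the difference.
\<close>

lemma difference_sym:
  "X \<in> vfs_near M p \<Longrightarrow> Y \<in> vfs_near M p \<Longrightarrow> difference p (X p) Y = difference p (Y p) X"
  using D_torsion_free[OF p, of X Y] twin.D_torsion_free[OF p, of X Y]
  unfolding difference_def by (simp add: algebra_simps)

lemma difference_in:
  "x \<in> tangent_space M p \<Longrightarrow> Y \<in> vfs_near M p \<Longrightarrow> difference p x Y \<in> tangent_space M p"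
  unfolding difference_def by (intro subspace_diff[OF subspace] D_in twin.D_in p)

text \<open>
  Here \<open>F(x, y, z)\<close> is \<open>(D\<^sub>x g')(y, z)\<close> for the associated metric \<open>g'\<close>. As \<open>D' g' = 0\<close>, only the
  difference of the connections contributes.
\<close>

lemma F_eq_difference:
  assumes "x \<in> tangent_space M p" "Y \<in> vfs_near M p" "Z \<in> vfs_near M p"
  shows "F_tensor M J g D p x (Y p) (Z p) =
    g p (J p (difference p x Y)) (Z p) + g p (J p (difference p x Z)) (Y p)"
proof -
  have V: "Y p \<in> tangent_space M p" "Z p \<in> tangent_space M p"
    "D p x Y \<in> tangent_space M p" "D p x Z \<in> tangent_space M p"
    "D' p x Y \<in> tangent_space M p" "D' p x Z \<in> tangent_space M p"
    using vfs_near_tangent D_in twin.D_in p assms by auto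
  have sw: "g p (J p y) z = g p (J p z) y" if "y \<in> tangent_space M p" "z \<in> tangent_space M p" for y z
    using that J_self_adjoint g_sym J_in by metis
  have df: "J p (difference p x W) = J p (D' p x W) - J p (D p x W)"
    if "D' p x W \<in> tangent_space M p" "D p x W \<in> tangent_space M p" for W
    unfolding difference_def using J_linear[OF that, of 1 "-1"] by simp
  have "F_tensor M J g D p x (Y p) (Z p) =
      g p (J p (D' p x Y)) (Z p) + g p (J p (Y p)) (D' p x Z)
      - g p (J p (Y p)) (D p x Z) - g p (J p (D p x Y)) (Z p)"
    using F_tensor_field[OF p assms(1,2)] nabla_J_field_eq_deriv[OF p assms]
      twin.D_metric[OF p assms] by (simp add: associated_metric_def)
  also have "\<dots> = g p (J p (difference p x Y)) (Z p) + g p (J p (difference p x Z)) (Y p)"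
    using V by (simp add: df g_diff J_in sw[of "Y p"])
  finally show ?thesis .
qed

text \<open>
  Koszul's trick: the alternating sum over \<open>F_eq_difference\<close> isolates one term, because the
  difference is symmetric.
\<close>

lemma difference_Koszul:
  assumes "X \<in> vfs_near M p" "Y \<in> vfs_near M p" "Z \<in> vfs_near M p"
  shows "2 * g p (J p (difference p (X p) Y)) (Z p) =
    F_tensor M J g D p (X p) (Y p) (Z p) + F_tensor M J g D p (Y p) (Z p) (X p)
    - F_tensor M J g D p (Z p) (X p) (Y p)"
  using assms vfs_near_tangent
    difference_sym[OF assms(1,2)] difference_sym[OF assms(1,3)] difference_sym[OF assms(2,3)]
  by (simp add: F_eq_difference)

text \<open>
  With \<open>S = D' - D\<close> one has \<open>(D'\<^sub>x J) y = (D\<^sub>x J) y + S(x, J y) - J S(x, y)\<close>. Pairing with \<open>z\<close> by the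
  associated metric, the Koszul formula expresses the last two terms through \<open>F\<close>, and
  \<open>F(x, J y, z) = - F(x, y, J z)\<close> removes the terms with \<open>x\<close> in the first slot.
\<close>

lemma F_tensor_twin:
  assumes "x \<in> tangent_space M p" "y \<in> tangent_space M p" "z \<in> tangent_space M p"
  shows "F_tensor M J (associated_metric J g) D' p x y z = twin_tensor (J p) (F_tensor M J g D p) x y z"
proof -
  interpret norden_tensor "tangent_space M p" "g p" "J p" "F_tensor M J g D p"
    by (rule norden_tensor_F[OF p])
  obtain X where X: "X \<in> vfs_near M p" "X p = x" using tangent_vector_extends[OF p assms(1)] by blast
  obtain Y where Y: "Y \<in> vfs_near M p" "Y p = y" using tangent_vector_extends[OF p assms(2)] by blast
  obtain Z where Z: "Z \<in> vfs_near M p" "Z p = z" using tangent_vector_extends[OF p assms(3)] by blast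
  let ?JY = "\<lambda>q. J q (Y q)" and ?JZ = "\<lambda>q. J q (Z q)"
  let ?N = "nabla_J_field p x Y" and ?S = "difference p x Y" and ?SJ = "difference p x ?JY"
  have V: "?N \<in> tangent_space M p" "?S \<in> tangent_space M p" "?SJ \<in> tangent_space M p"
    "D p x Y \<in> tangent_space M p" "D' p x Y \<in> tangent_space M p"
    using nabla_J_field_in[OF p] difference_in D_in twin.D_in p assms J_vfs_near Y by auto
  have "J p ?S = J p (D' p x Y) - J p (D p x Y)"
    unfolding difference_def using J_linear[OF V(5,4), of 1 "-1"] by simp
  then have "twin.nabla_J_field p x Y = (?N + ?SJ) - J p ?S"
    unfolding twin.nabla_J_field_def nabla_J_field_def difference_def[of p x ?JY] by simp
  then have "F_tensor M J (associated_metric J g) D' p x y z = g p (J p ((?N + ?SJ) - J p ?S)) z"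
    using twin.F_tensor_field[OF p assms(1) Y(1)] Y(2) by (simp add: associated_metric_def)
  also have "\<dots> = g p (J p ?N) z + g p (J p ?SJ) z - g p (J p (J p ?S)) z"
  proof -
    interpret a: norden_space "tangent_space M p" "\<lambda>x y. g p (J p x) y" "J p"
      by (rule norden_space_associated)
    show ?thesis
      using a.g_diff[of "?N + ?SJ" "J p ?S" z] a.g_add[of ?N ?SJ z] V assms(3) J_in subspace_add[OF subspace] by simp
  qed
  also have "g p (J p ?N) z = F_tensor M J g D p x y (J p z)"
    using F_tensor_field[OF p assms(1) Y(1)] Y(2) J_self_adjoint V(1) assms(3) by simp
  also have "g p (J p ?SJ) z =
      (F_tensor M J g D p x (J p y) z + F_tensor M J g D p (J p y) z x - F_tensor M J g D p z x (J p y)) / 2"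
    using difference_Koszul[OF X(1) J_vfs_near[OF Y(1)] Z(1)] X Y Z by simp
  also have "g p (J p (J p ?S)) z =
      (F_tensor M J g D p x y (J p z) + F_tensor M J g D p y (J p z) x - F_tensor M J g D p (J p z) x y) / 2"
    using difference_Koszul[OF X(1) Y(1) J_vfs_near[OF Z(1)]] J_self_adjoint[of "J p ?S" z] J_in V(2) assms(3)
      X Y Z by simp
  finally show ?thesis
    using assms by (simp add: twin_tensor_def F_J_left field_simps)
qed

lemma theta_form_twin:
  assumes z: "z \<in> tangent_space M p"
  shows "theta_form M J (associated_metric J g) D' p z = theta_form M J g D p z"
proof -
  let ?B = "SOME B. tangent_basis M p B"
  interpret norden_tensor "tangent_space M p" "g p" "J p" "F_tensor M J g D p"
    by (rule norden_tensor_F[OF p])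
  interpret form_with_basis "tangent_space M p" "g p" ?B
    by (rule form_with_basis_SOME[OF p])
  obtain d where d: "dual_family (tangent_space M p) (g p) ?B d"
    using dual_family_exists by blast
  have B: "?B \<subseteq> tangent_space M p" using B_in by blast
  have "dual_family (tangent_space M p) (associated_metric J g p) ?B (\<lambda>a. - J p (d a))"
    using dual_family_associated[OF d B] by (simp add: associated_metric_def)
  then have "theta_form M J (associated_metric J g) D' p z =
      (\<Sum>a\<in>?B. F_tensor M J (associated_metric J g) D' p a (- J p (d a)) z)"
    using twin.theta_form_dual[OF p _ z] by blast
  also have "\<dots> = (\<Sum>a\<in>?B. twin_tensor (J p) (F_tensor M J g D p) a (- J p (d a)) z)"
    using B_in d_in[OF d] z by (intro sum.cong F_tensor_twin minus_in J_in) auto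
  also have "\<dots> = (\<Sum>a\<in>?B. F_tensor M J g D p a (d a) z)"
    using form_with_basis_SOME[OF p] d z by (rule trace_twin)
  also have "\<dots> = theta_form M J g D p z"
    using theta_form_dual[OF p d z] ..
  finally show ?thesis .
qed

lemma class_condition_interchange:
  "class_condition W n (tangent_space M p) (J p) (g p) (F_tensor M J g D p) (theta_form M J g D p) \<longleftrightarrow>
   class_condition W n (tangent_space M p) (J p) (associated_metric J g p)
     (F_tensor M J (associated_metric J g) D' p) (theta_form M J (associated_metric J g) D' p)"
proof -
  interpret norden_tensor "tangent_space M p" "g p" "J p" "F_tensor M J g D p"
    by (rule norden_tensor_F[OF p])
  interpret form_with_basis "tangent_space M p" "g p" "SOME B. tangent_basis M p B"
    by (rule form_with_basis_SOME[OF p])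
  obtain d where d: "dual_family (tangent_space M p) (g p) (SOME B. tangent_basis M p B) d"
    using dual_family_exists by blast
  have "theta_form M J g D p (- z) = - theta_form M J g D p z" if "z \<in> tangent_space M p" for z
    using that B_in d_in[OF d]
    by (simp add: theta_form_dual[OF p d] minus_in F_minus3 sum_negf)
  from class_condition_twin_iff[of "theta_form M J g D p" W n, OF this] show ?thesis
    using class_condition_cong[OF J_in F_tensor_twin theta_form_twin]
    by (simp add: associated_metric_def)
qed

end

end

theorem theorem2p4:
  fixes M :: "('m, 'e::euclidean_space) mfd"
    and J :: "('m, 'e) endo_field"
    and g :: "('m, 'e) bilin_field"
    and D D' :: "('m, 'e) connection"
    and n :: nat
    and W :: norden_class
  assumes "almost_norden_manifold n M J g"
    and "levi_civita_connection M g D"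
    and "levi_civita_connection M (associated_metric J g) D'"
  shows "belongs_to_class W n M J g D \<longleftrightarrow>
         belongs_to_class W n M J (associated_metric J g) D'"
proof -
  interpret almost_norden n M J g by (rule almost_norden.intro[OF assms(1)])
  interpret a: almost_norden n M J "associated_metric J g" by (rule almost_norden_associated)
  interpret twin_connections n M J g D D'
    by unfold_locales (rule assms)+
  show ?thesis
    unfolding belongs_to_class_def using class_condition_interchange by blast
qed

end
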